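(* Let $V$ be a finite-dimensional Euclidean Jordan algebra of rank $r$ with unit element $e$ and symmetric cone $\mathcal{P}_+$. Let $p$ be a hyperbolic polynomial of degree $m$ on $V$ with Gårding cone $\Gamma_+$. If $\Gamma_+ \supset \mathcal{P}_+$ and $p$ is $e$-central, that is, $\operatorname{tr}^{p,e}(x) = \frac{m}{r}\operatorname{tr}_{\mathcal{J}}(x)$ for all $x\in V$, then \[p(a)^{\frac{1}{m}} \geq p(e)^{\frac{1}{m}} \left(\det\nolimits_{\mathcal{J}}a\right)^{\frac{1}{r}} \quad \text{for every } a \in \mathcal{P}_+.\]
   Context: Jordan algebras. A (real, unital) Jordan algebra is a real vector space $V$ with a bilinear product $\circ$ satisfying $x\circ y=y\circ x$ and $x\circ(x^2\circ y)=x^2\circ(x\circ y)$ for all $x,y$ (with $x^2=x\circ x$), and with a unit element $e$. It is Euclidean if it is finite-dimensional and has an inner product with $\langle x\circ y,z\rangle=\langle x,y\circ z\rangle$ for all $x,y,z$. The rank $r$ of $V$ is the maximum over $x\in V$ of the degree of the minimal polynomial of $x$. A Jordan frame is a set of pairwise orthogonal ($c_i\circ c_j=0$, $i\ne j$) primitive idempotents with sum $e$ (an idempotent, $c^2=c$, is primitive if it is nonzero and not a sum of two nonzero orthogonal idempotents). By the spectral theorem every $x\in V$ can be written $x=\sum_{i=1}^r\lambda_i(x)c_i$ for some Jordan frame $\{c_1,\dots,c_r\}$ and real numbers $\lambda_i(x)$, which are uniquely determined with multiplicity (the Jordan eigenvalues of $x$). Define $\operatorname{tr}_{\mathcal{J}}x=\sum_{i=1}^r\lambda_i(x)$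 and $\det_{\mathcal{J}}x=\prod_{i=1}^r\lambda_i(x)$. The symmetric cone is $\mathcal{P}_+=\{x\in V:\lambda_i(x)>0\ \forall i\}$, the interior of $\{x^2:x\in V\}$. Hyperbolic polynomials. A homogeneous polynomial $p$ of degree $m$ (with $m \ge 1$) on a finite-dimensional real vector space $V$ is hyperbolic with respect to $a\in V$ ($a$-hyperbolic) if $p(a)>0$ and for every $x\in V$ the polynomial $s\mapsto p(sa+x)$ has only real roots; then $p(sa+x)=p(a)\prod_{j=1}^m(s+\lambda_j^{p,a}(x))$ with real $\lambda_j^{p,a}(x)$. Its Gårding cone is $\Gamma_+=\{x:\lambda^{p,a}_j(x)>0\ \forall j\}$, equivalently the connected component of $\{p>0\}$ containing $a$; by Gårding's theorem $p$ is $b$-hyperbolic with the same Gårding cone for every $b\in\Gamma_+$. Set $\operatorname{tr}^{p,a}(x)=\sum_{j=1}^m\lambda_j^{p,a}(x)$. *)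

theory Defs
  imports "HOL-Analysis.Analysis" "HOL-Computational_Algebra.Computational_Algebra"
begin

text \<open>
  The type class \<^class>\<open>euclidean_space\<close> only serves to provide a finite-dimensional real vector
  space \<open>V\<close>: the inner product of a Euclidean Jordan algebra is a separate object and need not be
  the inner product of the type class. A Jordan algebra is given by its product \<open>jp\<close> and its
  unit \<open>e\<close>.
\<close>

definition jordan_algebra :: "('a::real_vector \<Rightarrow> 'a \<Rightarrow> 'a) \<Rightarrow> 'a \<Rightarrow> bool" where
  "jordan_algebra jp e \<longleftrightarrow>
     bilinear jp \<and>
     (\<forall>x y. jp x y = jp y x) \<and>
     (\<forall>x y. jp x (jp (jp x x) y) = jp (jp x x) (jp x y)) \<and>
     (\<forall>x. jp e x = x)"

definition inner_product :: "('a::real_vector \<Rightarrow> 'a \<Rightarrow> real) \<Rightarrow> bool" where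
  "inner_product ip \<longleftrightarrow>
     bilinear ip \<and> (\<forall>x y. ip x y = ip y x) \<and> (\<forall>x. x \<noteq> 0 \<longrightarrow> ip x x > 0)"

definition euclidean_jordan_algebra :: "('a::euclidean_space \<Rightarrow> 'a \<Rightarrow> 'a) \<Rightarrow> 'a \<Rightarrow> bool" where
  "euclidean_jordan_algebra jp e \<longleftrightarrow>
     jordan_algebra jp e \<and>
     (\<exists>ip. inner_product ip \<and> (\<forall>x y z. ip (jp x y) z = ip x (jp y z)))"

primrec jpow :: "('a::real_vector \<Rightarrow> 'a \<Rightarrow> 'a) \<Rightarrow> 'a \<Rightarrow> 'a \<Rightarrow> nat \<Rightarrow> 'a" where
  "jpow jp e x 0 = e"
| "jpow jp e x (Suc n) = jp x (jpow jp e x n)"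

definition jpoly :: "('a::real_vector \<Rightarrow> 'a \<Rightarrow> 'a) \<Rightarrow> 'a \<Rightarrow> real poly \<Rightarrow> 'a \<Rightarrow> 'a" where
  "jpoly jp e q x = (\<Sum>i\<le>degree q. coeff q i *\<^sub>R jpow jp e x i)"

definition jordan_minpoly :: "('a::real_vector \<Rightarrow> 'a \<Rightarrow> 'a) \<Rightarrow> 'a \<Rightarrow> 'a \<Rightarrow> real poly" where
  "jordan_minpoly jp e x =
     (THE q. lead_coeff q = 1 \<and> jpoly jp e q x = 0 \<and>
        (\<forall>q'. q' \<noteq> 0 \<and> jpoly jp e q' x = 0 \<longrightarrow> degree q \<le> degree q'))"

text \<open>The degrees below are bounded by the dimension of the space, so the maximum exists.\<close>

definition jordan_rank :: "('a::euclidean_space \<Rightarrow> 'a \<Rightarrow> 'a) \<Rightarrow> 'a \<Rightarrow> nat" where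
  "jordan_rank jp e = Max (range (\<lambda>x. degree (jordan_minpoly jp e x)))"

definition idempotent :: "('a \<Rightarrow> 'a \<Rightarrow> 'a) \<Rightarrow> 'a \<Rightarrow> bool" where
  "idempotent jp c \<longleftrightarrow> jp c c = c"

definition primitive_idempotent :: "('a::real_vector \<Rightarrow> 'a \<Rightarrow> 'a) \<Rightarrow> 'a \<Rightarrow> bool" where
  "primitive_idempotent jp c \<longleftrightarrow>
     idempotent jp c \<and> c \<noteq> 0 \<and>
     \<not> (\<exists>c1 c2. idempotent jp c1 \<and> idempotent jp c2 \<and> c1 \<noteq> 0 \<and> c2 \<noteq> 0 \<and>
            jp c1 c2 = 0 \<and> c = c1 + c2)"

definition jordan_frame :: "('a::real_vector \<Rightarrow> 'a \<Rightarrow> 'a) \<Rightarrow> 'a \<Rightarrow> 'a set \<Rightarrow> bool" where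
  "jordan_frame jp e C \<longleftrightarrow>
     finite C \<and> (\<forall>c\<in>C. primitive_idempotent jp c) \<and>
     (\<forall>c\<in>C. \<forall>d\<in>C. c \<noteq> d \<longrightarrow> jp c d = 0) \<and> \<Sum>C = e"

text \<open>
  The eigenvalues of \<open>x\<close>, with multiplicity, read off from a representation
  \<open>x = \<Sum>i=1..r. \<lambda>\<^sub>i c\<^sub>i\<close> over a Jordan frame with \<open>r\<close> elements. The spectral theorem for
  Euclidean Jordan algebras guarantees that exactly one multiset has this property.
\<close>

definition jordan_eigenvalues ::
    "('a::euclidean_space \<Rightarrow> 'a \<Rightarrow> 'a) \<Rightarrow> 'a \<Rightarrow> 'a \<Rightarrow> real multiset" where
  "jordan_eigenvalues jp e x =
     (THE L. \<exists>C l. jordan_frame jp e C \<and> card C = jordan_rank jp e \<and>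
        x = (\<Sum>c\<in>C. l c *\<^sub>R c) \<and> L = image_mset l (mset_set C))"

definition jordan_trace :: "('a::euclidean_space \<Rightarrow> 'a \<Rightarrow> 'a) \<Rightarrow> 'a \<Rightarrow> 'a \<Rightarrow> real" where
  "jordan_trace jp e x = \<Sum>\<^sub># (jordan_eigenvalues jp e x)"

definition jordan_det :: "('a::euclidean_space \<Rightarrow> 'a \<Rightarrow> 'a) \<Rightarrow> 'a \<Rightarrow> 'a \<Rightarrow> real" where
  "jordan_det jp e x = \<Prod>\<^sub># (jordan_eigenvalues jp e x)"

definition symmetric_cone :: "('a::euclidean_space \<Rightarrow> 'a \<Rightarrow> 'a) \<Rightarrow> 'a \<Rightarrow> 'a set" where
  "symmetric_cone jp e = {x. \<forall>l \<in># jordan_eigenvalues jp e x. l > 0}"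

text \<open>
  A polynomial on \<open>V\<close> is identified with its polynomial function, which over the reals loses no
  information; homogeneity of degree \<open>m\<close> is then the usual scaling identity.
\<close>

definition homogeneous_polynomial :: "nat \<Rightarrow> ('a::euclidean_space \<Rightarrow> real) \<Rightarrow> bool" where
  "homogeneous_polynomial m p \<longleftrightarrow>
     real_polynomial_function p \<and> (\<forall>t x. p (t *\<^sub>R x) = t ^ m * p x)"

text \<open>The univariate polynomial \<open>s \<mapsto> p (s a + x)\<close>; see \<open>poly_line_poly\<close> below.\<close>

definition line_poly :: "('a::euclidean_space \<Rightarrow> real) \<Rightarrow> 'a \<Rightarrow> 'a \<Rightarrow> real poly" where
  "line_poly p a x = (THE q. \<forall>s. poly q s = p (s *\<^sub>R a + x))"

definition hyperbolic :: "nat \<Rightarrow> ('a::euclidean_space \<Rightarrow> real) \<Rightarrow> 'a \<Rightarrow> bool" where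
  "hyperbolic m p a \<longleftrightarrow>
     m \<ge> 1 \<and> homogeneous_polynomial m p \<and> p a > 0 \<and>
     (\<forall>x. \<forall>z::complex. poly (map_poly complex_of_real (line_poly p a x)) z = 0 \<longrightarrow> z \<in> \<real>)"

text \<open>
  The multiset of the \<open>\<lambda>\<^sub>j(x)\<close> in \<open>p (s a + x) = p a * (\<Prod>j. s + \<lambda>\<^sub>j(x))\<close>.
\<close>

definition hyp_eigenvalues :: "('a::euclidean_space \<Rightarrow> real) \<Rightarrow> 'a \<Rightarrow> 'a \<Rightarrow> real multiset" where
  "hyp_eigenvalues p a x =
     (THE L. \<forall>s. p (s *\<^sub>R a + x) = p a * (\<Prod>l\<in>#L. s + l))"

definition garding_cone :: "('a::euclidean_space \<Rightarrow> real) \<Rightarrow> 'a \<Rightarrow> 'a set" where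
  "garding_cone p a = {x. \<forall>l \<in># hyp_eigenvalues p a x. l > 0}"

definition hyp_trace :: "('a::euclidean_space \<Rightarrow> real) \<Rightarrow> 'a \<Rightarrow> 'a \<Rightarrow> real" where
  "hyp_trace p a x = \<Sum>\<^sub># (hyp_eigenvalues p a x)"

definition central :: "('a::euclidean_space \<Rightarrow> 'a \<Rightarrow> 'a) \<Rightarrow> 'a \<Rightarrow> nat \<Rightarrow> ('a \<Rightarrow> real) \<Rightarrow> bool" where
  "central jp e m p \<longleftrightarrow>
     (\<forall>x. hyp_trace p e x = real m / real (jordan_rank jp e) * jordan_trace jp e x)"

lemma line_poly_exists:
  assumes "real_polynomial_function p"
  shows "\<exists>q. \<forall>s. poly q s = p (s *\<^sub>R a + x)"
  using assms
proof induction
  case (linear f)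
  interpret bounded_linear f by fact
  have "\<forall>s. poly [:f x, f a:] s = f (s *\<^sub>R a + x)"
    by (simp add: add scaleR)
  then show ?case ..
next
  case (const c)
  have "\<forall>s. poly [:c:] s = c"
    by simp
  then show ?case ..
next
  case (add f g)
  then obtain q r where "\<forall>s. poly q s = f (s *\<^sub>R a + x)" "\<forall>s. poly r s = g (s *\<^sub>R a + x)"
    by blast
  then have "\<forall>s. poly (q + r) s = f (s *\<^sub>R a + x) + g (s *\<^sub>R a + x)"
    by simp
  then show ?case ..
next
  case (mult f g)
  then obtain q r where "\<forall>s. poly q s = f (s *\<^sub>R a + x)" "\<forall>s. poly r s = g (s *\<^sub>R a + x)"
    by blast
  then have "\<forall>s. poly (q * r) s = f (s *\<^sub>R a + x) * g (s *\<^sub>R a + x)"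
    by simp
  then show ?case ..
qed

lemma poly_line_poly:
  assumes "real_polynomial_function p"
  shows "poly (line_poly p a x) s = p (s *\<^sub>R a + x)"
proof -
  obtain q where q: "\<forall>s. poly q s = p (s *\<^sub>R a + x)"
    using line_poly_exists[OF assms] by blast
  have "line_poly p a x = q"
    unfolding line_poly_def
  proof (rule the_equality[where a = q])
    show "q' = q" if "\<forall>s. poly q' s = p (s *\<^sub>R a + x)" for q'
      using that q by (simp add: fun_eq_iff flip: poly_eq_poly_eq_iff)
  qed (fact q)
  with q show ?thesis
    by simp
qed

lemma hyp_eigenvalues_unique:
  assumes "p a \<noteq> 0" and L: "\<And>s. p (s *\<^sub>R a + x) = p a * (\<Prod>l\<in>#L. s + l)"
  shows "hyp_eigenvalues p a x = L"
  unfolding hyp_eigenvalues_def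
proof (rule the_equality[where a = L])
  fix M assume M: "\<forall>s. p (s *\<^sub>R a + x) = p a * (\<Prod>l\<in>#M. s + l)"
  have eval: "poly (\<Prod>l\<in>#K. [:l, 1:]) s = (\<Prod>l\<in>#K. s + l)" for K and s :: real
    by (induction K) (auto simp: algebra_simps)
  have roots: "proots (\<Prod>l\<in>#K. [:l, 1:]) = image_mset uminus K" for K :: "real multiset"
  proof (induction K)
    case (add l K)
    have "(\<Prod>l\<in>#K. [:l, 1:]) \<noteq> 0"
      by (auto simp: prod_mset_zero_iff)
    with add show ?case
      by (subst image_mset_add_mset, subst prod_mset.add_mset, subst proots_mult) auto
  qed simp
  have "(\<Prod>l\<in>#M. [:l, 1:]) = (\<Prod>l\<in>#L. [:l, 1:])"
    using M L assms(1) by (auto simp: eval fun_eq_iff simp flip: poly_eq_poly_eq_iff)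
  then have "image_mset uminus M = image_mset uminus L"
    by (metis roots)
  then have "image_mset uminus (image_mset uminus M) = image_mset uminus (image_mset uminus L)"
    by (rule arg_cong)
  then show "M = L"
    by (simp add: multiset.map_comp comp_def)
qed (use L in blast)

end

theory Submission
  imports Defs
begin

text \<open>
  Write \<open>a = \<Sum>\<^sub>c l(c) c\<close> over a Jordan frame \<open>C\<close>. Every combination of \<open>C\<close> with positive
  coefficients lies in the symmetric cone, so by Garding's theorem \<open>p\<close> is hyperbolic in that
  direction. By homogeneity all \<open>l(c) \<ge> 1\<close>. Start at \<open>e\<close> and raise the coefficients to their final
  values step by step, each step multiplying the coefficients of some \<open>S \<subseteq> C\<close> by
  \<open>\<theta> \<ge> 1\<close> while the others are still \<open>1\<close>. With \<open>w = \<Sum>(C - S)\<close> and \<open>v\<close> the current point, Bernoulli's inequality for the eigenvalues of \<open>w\<close> in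
  direction \<open>v\<close> shows that the step multiplies \<open>p\<close> by at least \<open>\<theta>\<close> to the power
  \<open>m - tr\<^bsup>p,v\<^esup>(w)\<close>. Since \<open>v - e\<close> lies in the closed cone, \<open>tr\<^bsup>p,v\<^esup>(w) \<le> tr\<^bsup>p,e\<^esup>(w)\<close>, and the
  latter is \<open>m (r - |S|) / r\<close> because \<open>p\<close> is central; so the step contributes at least
  \<open>\<theta>\<^bsup>m|S|/r\<^esup>\<close>, which is the corresponding factor of \<open>(det a)\<^bsup>m/r\<^esup>\<close>. The trace inequality holds
  because \<open>s \<mapsto> tr\<^bsup>p,v+sc\<^esup>(w)\<close> is a rational function mapping the upper half plane to the lower one.
\<close>

subsection \<open>Spectral theory of Euclidean Jordan algebras\<close>

locale euclidean_jordan =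
  fixes jp :: "'a::euclidean_space \<Rightarrow> 'a \<Rightarrow> 'a" (infixl "\<odot>" 70)
    and e :: 'a
    and ip :: "'a \<Rightarrow> 'a \<Rightarrow> real"
  assumes jordan: "jordan_algebra jp e"
    and ip: "inner_product ip"
    and ip_assoc: "ip (x \<odot> y) z = ip x (y \<odot> z)"
begin

section \<open>Bilinear calculus and polarized forms of the Jordan identity\<close>

lemma bilinear_jp: "bilinear (\<odot>)"
  and jp_commute: "x \<odot> y = y \<odot> x"
  and jordan_identity: "x \<odot> (x \<odot> x \<odot> y) = x \<odot> x \<odot> (x \<odot> y)"
  and unit_left [simp]: "e \<odot> x = x"
  using jordan unfolding jordan_algebra_def by auto

lemma unit_right [simp]: "x \<odot> e = x"
  using unit_left jp_commute by metis

lemmas jp_simps =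
  bilinear_ladd[OF bilinear_jp] bilinear_radd[OF bilinear_jp]
  bilinear_lmul[OF bilinear_jp] bilinear_rmul[OF bilinear_jp]
  bilinear_lsub[OF bilinear_jp] bilinear_rsub[OF bilinear_jp]
  bilinear_lzero[OF bilinear_jp] bilinear_rzero[OF bilinear_jp]
  bilinear_lneg[OF bilinear_jp] bilinear_rneg[OF bilinear_jp]

lemma jp_sum_left: "sum f A \<odot> y = (\<Sum>i\<in>A. f i \<odot> y)"
  by (rule linear_sum) (use bilinear_jp in \<open>auto simp: bilinear_def\<close>)

lemma jp_sum_right: "y \<odot> sum f A = (\<Sum>i\<in>A. y \<odot> f i)"
  by (rule linear_sum) (use bilinear_jp in \<open>auto simp: bilinear_def\<close>)

lemma bilinear_ip: "bilinear ip"
  and ip_commute: "ip x y = ip y x"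
  and ip_pos: "x \<noteq> 0 \<Longrightarrow> ip x x > 0"
  using ip unfolding inner_product_def by auto

lemmas ip_simps =
  bilinear_ladd[OF bilinear_ip] bilinear_radd[OF bilinear_ip]
  bilinear_lmul[OF bilinear_ip] bilinear_rmul[OF bilinear_ip]
  bilinear_lsub[OF bilinear_ip] bilinear_rsub[OF bilinear_ip]
  bilinear_lzero[OF bilinear_ip] bilinear_rzero[OF bilinear_ip]

lemma ip_sum_right: "ip y (sum f A) = (\<Sum>i\<in>A. ip y (f i))"
  by (rule linear_sum) (use bilinear_ip in \<open>auto simp: bilinear_def\<close>)

lemma ip_nonneg: "ip x x \<ge> 0"
  using ip_pos[of x] by (cases "x = 0") (auto simp: ip_simps)

lemma ip_eq_0_iff: "ip x x = 0 \<longleftrightarrow> x = 0"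
  using ip_pos[of x] by (cases "x = 0") (auto simp: ip_simps)

text \<open>Pairing with \<open>e\<close> turns each square into a squared norm, by associativity of
  \<open>ip\<close>; positive definiteness then makes the algebra formally real.\<close>

lemma sum_squares_eq_0:
  assumes "x \<odot> x + y \<odot> y = 0"
  shows "x = 0" "y = 0"
proof -
  have "ip (x \<odot> x + y \<odot> y) e = ip x x + ip y y"
    by (simp add: ip_simps ip_assoc)
  with assms have "ip x x + ip y y = 0"
    by (simp add: ip_simps)
  then have "ip x x = 0" "ip y y = 0"
    using ip_nonneg[of x] ip_nonneg[of y] by linarith+
  then show "x = 0" "y = 0"
    by (simp_all add: ip_eq_0_iff)
qed

lemma unit_nonzero: "e \<noteq> 0"
proof
  assume "e = 0"
  then have "x = 0" for x :: 'a
    using unit_left[of x] by (simp add: jp_simps)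
  \<comment> \<open>The class \<open>euclidean_space\<close> excludes the zero space.\<close>
  then show False
    using nonempty_Basis nonzero_Basis by blast
qed

text \<open>Full polarization of the Jordan identity, which is cubic in its first variable: the
  alternating sum of \<open>f\<close> over the sums of nonempty subfamilies of \<open>x\<close>,
  \<open>y\<close>, \<open>z\<close> isolates twice the part linear in each. Coordinates along
  \<open>b\<close> make this an identity between real numbers.\<close>

lemma linearized_jordan_identity:
  "x \<odot> (y \<odot> z \<odot> w) + y \<odot> (x \<odot> z \<odot> w) + z \<odot> (x \<odot> y \<odot> w) =
   y \<odot> z \<odot> (x \<odot> w) + x \<odot> z \<odot> (y \<odot> w) + x \<odot> y \<odot> (z \<odot> w)"
proof (rule euclidean_eqI)
  fix b :: 'a assume "b \<in> Basis"
  define f where "f u = inner (u \<odot> (u \<odot> u \<odot> w)) b - inner (u \<odot> u \<odot> (u \<odot> w)) b" for u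
  have f0: "f u = 0" for u
    by (simp add: f_def jordan_identity)
  note comm = jp_commute[of y x] jp_commute[of z x] jp_commute[of z y]
  have "f (x + y + z) - f (x + y) - f (x + z) - f (y + z) + f x + f y + f z =
     2 * inner (x \<odot> (y \<odot> z \<odot> w) + y \<odot> (x \<odot> z \<odot> w) + z \<odot> (x \<odot> y \<odot> w)) b -
     2 * inner (y \<odot> z \<odot> (x \<odot> w) + x \<odot> z \<odot> (y \<odot> w) + x \<odot> y \<odot> (z \<odot> w)) b"
    unfolding f_def by (simp add: jp_simps inner_add_left comm)
  then show "inner (x \<odot> (y \<odot> z \<odot> w) + y \<odot> (x \<odot> z \<odot> w) + z \<odot> (x \<odot> y \<odot> w)) b =
     inner (y \<odot> z \<odot> (x \<odot> w) + x \<odot> z \<odot> (y \<odot> w) + x \<odot> y \<odot> (z \<odot> w)) b"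
    by (simp add: f0)
qed

text \<open>The polarized identity with \<open>u\<close> moved out: multiplication by a triple
  product is expressed through multiplications by its factors and their pairwise products. This
  drives the recursion for powers.\<close>

lemma triple_product_operator:
  "x \<odot> y \<odot> w \<odot> u =
     x \<odot> w \<odot> (y \<odot> u) + y \<odot> w \<odot> (x \<odot> u) + x \<odot> y \<odot> (w \<odot> u)
     - x \<odot> (w \<odot> (y \<odot> u)) - y \<odot> (w \<odot> (x \<odot> u))"
  using linearized_jordan_identity[of x y u w] jp_commute
  by (smt (verit) add.commute add_diff_cancel_left' diff_diff_add add.assoc)

text \<open>Multiplication by the power \<open>k + 2\<close> is a polynomial expression in the
  multiplications by \<open>x\<close>, by its square and by the powers \<open>k\<close> and
  \<open>k + 1\<close>. Each of these commutes with multiplication by \<open>x\<close>: the square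
  by the Jordan identity, the powers by induction.\<close>

lemma jpow_operator_commute:
  "x \<odot> (jpow (\<odot>) e x n \<odot> u) = jpow (\<odot>) e x n \<odot> (x \<odot> u)"
proof (induction n arbitrary: u rule: less_induct)
  case (less n)
  consider "n = 0" | "n = 1" | k where "n = Suc (Suc k)"
    by (metis One_nat_def not0_implies_Suc)
  then show ?case
  proof cases
    case (3 k)
    let ?P = "jpow (\<odot>) e x"
    have op: "?P n \<odot> v = ?P (Suc k) \<odot> (x \<odot> v) + ?P (Suc k) \<odot> (x \<odot> v) + x \<odot> x \<odot> (?P k \<odot> v)
       - x \<odot> (x \<odot> (?P k \<odot> v)) - ?P k \<odot> (x \<odot> (x \<odot> v))" for v
      using triple_product_operator[of x "?P k" x v] jp_commute[of "?P k" x] jp_commute[of x "x \<odot> ?P k"]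
      by (simp add: 3 algebra_simps)
    have k: "x \<odot> (?P k \<odot> v) = ?P k \<odot> (x \<odot> v)" "x \<odot> (x \<odot> ?P k \<odot> v) = x \<odot> ?P k \<odot> (x \<odot> v)" for v
      using less[of k v] less[of "Suc k" v] 3 by auto
    show ?thesis
      unfolding op by (simp add: jp_simps k jordan_identity)
  qed auto
qed

section \<open>Polynomials in one element\<close>

abbreviation ev :: "real poly \<Rightarrow> 'a \<Rightarrow> 'a" where
  "ev \<equiv> jpoly (\<odot>) e"

lemma ev_bound:
  assumes "degree q \<le> n"
  shows "ev q x = (\<Sum>i\<le>n. coeff q i *\<^sub>R jpow (\<odot>) e x i)"
  unfolding jpoly_def
  by (rule sum.mono_neutral_left) (use assms in \<open>auto simp: coeff_eq_0\<close>)

lemma ev_add: "ev (p + q) x = ev p x + ev q x"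
  by (simp add: ev_bound[of _ "max (degree p) (degree q)"] degree_add_le_max
      scaleR_add_left sum.distrib)

lemma ev_smult: "ev (smult a q) x = a *\<^sub>R ev q x"
  by (simp add: ev_bound[of _ "degree q"] degree_smult_le scaleR_sum_right)

lemma ev_0 [simp]: "ev 0 x = 0"
  by (simp add: jpoly_def)

lemma ev_diff: "ev (p - q) x = ev p x - ev q x"
  using ev_add[of "p - q" q x] by simp

lemma ev_sum: "ev (sum f A) x = (\<Sum>i\<in>A. ev (f i) x)"
  by (induction A rule: infinite_finite_induct) (simp_all add: ev_add)

lemma ev_pCons: "ev (pCons a q) x = a *\<^sub>R e + x \<odot> ev q x"
proof -
  have "ev (pCons a q) x = (\<Sum>i\<le>Suc (degree q). coeff (pCons a q) i *\<^sub>R jpow (\<odot>) e x i)"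
    by (rule ev_bound) (rule degree_pCons_le)
  also have "\<dots> = a *\<^sub>R e + x \<odot> ev q x"
    by (simp add: sum.atMost_Suc_shift jp_sum_right jp_simps jpoly_def del: sum.atMost_Suc)
  finally show ?thesis .
qed

lemma ev_1 [simp]: "ev 1 x = e"
  by (simp add: one_pCons ev_pCons jp_simps)

lemma ev_X [simp]: "ev [:0, 1:] x = x"
  by (simp add: ev_pCons jp_simps)

lemma ev_operator_commute: "x \<odot> (ev q x \<odot> u) = ev q x \<odot> (x \<odot> u)"
  unfolding jpoly_def by (simp add: jp_sum_left jp_sum_right jp_simps jpow_operator_commute)

text \<open>Power associativity: the subalgebra generated by \<open>x\<close> is associative,
  because multiplication by \<open>x\<close> commutes with multiplication by every
  \<open>ev q x\<close>.\<close>

lemma ev_mult: "ev (p * q) x = ev p x \<odot> ev q x"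
proof (induction p)
  case (pCons a p)
  have "x \<odot> (ev p x \<odot> ev q x) = x \<odot> ev p x \<odot> ev q x"
    using ev_operator_commute[of x q "ev p x"] jp_commute by metis
  with pCons show ?case
    by (simp add: ev_add ev_smult ev_pCons jp_simps)
qed (simp add: jp_simps)

text \<open>The powers with exponents up to the dimension are too many to be independent. Dependence
  is a property of sets, so a repetition among these powers is treated separately and gives a
  difference of two monomials.\<close>

lemma annihilating_poly_exists: "\<exists>q. q \<noteq> 0 \<and> ev q x = 0"
proof -
  let ?n = "DIM('a)" and ?P = "jpow (\<odot>) e x"
  have mon: "ev (monom a i) x = a *\<^sub>R ?P i" for a i
    by (induction i) (simp_all add: monom_0 monom_Suc ev_pCons jp_simps)
  show ?thesis
  proof (cases "inj_on ?P {..?n}")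
    case False
    then obtain i j where ij: "i \<noteq> j" "?P i = ?P j"
      unfolding inj_on_def by blast
    have "coeff (monom (1::real) i - monom 1 j) i = 1"
      using ij(1) by simp
    then have "monom (1::real) i - monom 1 j \<noteq> 0"
      by fastforce
    moreover have "ev (monom 1 i - monom 1 j) x = 0"
      using ij by (simp add: ev_diff mon)
    ultimately show ?thesis
      by blast
  next
    case True
    then have "card (?P ` {..?n}) > ?n"
      by (simp add: card_image)
    then have "dependent (?P ` {..?n})"
      by (intro dependent_biggerset) auto
    then obtain u v where u: "v \<in> ?P ` {..?n}" "u v \<noteq> 0" "(\<Sum>v\<in>?P ` {..?n}. u v *\<^sub>R v) = 0"
      by (subst (asm) dependent_finite) auto
    define q where "q = (\<Sum>i\<le>?n. monom (u (?P i)) i)"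
    have "ev q x = 0"
      using u(3) True by (simp add: q_def ev_sum mon sum.reindex)
    moreover obtain i where i: "i \<le> ?n" "v = ?P i"
      using u(1) by auto
    have "coeff q i = u v"
      using i by (simp add: q_def coeff_sum)
    then have "q \<noteq> 0"
      using u(2) by auto
    ultimately show ?thesis
      by blast
  qed
qed

end

section \<open>Factorization of real polynomials\<close>

lemma linear_factors_dvd:
  fixes q :: "'b::idom poly"
  assumes "finite A" "\<And>a. a \<in> A \<Longrightarrow> poly q a = 0"
  shows "(\<Prod>a\<in>A. [:-a, 1:]) dvd q"
  using assms
proof (induction A arbitrary: q rule: finite_induct)
  case (insert a A)
  then obtain g where g: "q = [:-a, 1:] * g"
    using poly_eq_0_iff_dvd[of q a] by (auto elim: dvdE)
  have "poly g b = 0" if "b \<in> A" for b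
    using insert.prems[of b] insert.hyps(2) that unfolding g poly_mult by auto
  then have "(\<Prod>a\<in>A. [:-a, 1:]) dvd g"
    by (rule insert.IH)
  then show ?case
    unfolding g prod.insert[OF insert.hyps] by (rule mult_dvd_mono[OF dvd_refl])
qed simp

text \<open>The divisor is the real minimal polynomial of the nonreal root. The remainder has degree
  at most one, and a real polynomial of that degree with a nonreal root is zero.\<close>

lemma real_quadratic_factor:
  fixes q :: "real poly"
  assumes "poly (map_poly of_real q) (Complex \<alpha> \<beta>) = 0" "\<beta> \<noteq> 0"
  shows "[:\<alpha>\<^sup>2 + \<beta>\<^sup>2, -2 * \<alpha>, 1:] dvd q"
proof -
  let ?d = "[:\<alpha>\<^sup>2 + \<beta>\<^sup>2, -2 * \<alpha>, 1:]" and ?z = "Complex \<alpha> \<beta>"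
  let ?c = "map_poly of_real :: real poly \<Rightarrow> complex poly"
  define r where "r = q mod ?d"
  have hom: "?c (f + g) = ?c f + ?c g" "?c (f * g) = ?c f * ?c g" for f g
    by (rule poly_eqI; simp add: coeff_map_poly coeff_mult)+
  have "poly (?c ?d) ?z = 0"
    by (simp add: complex_eq_iff map_poly_pCons power2_eq_square algebra_simps)
  moreover have "q = ?d * (q div ?d) + r"
    by (simp only: r_def mult_div_mod_eq)
  then have "poly (?c q) ?z = poly (?c ?d) ?z * poly (?c (q div ?d)) ?z + poly (?c r) ?z"
    by (metis hom poly_add poly_mult)
  ultimately have r: "poly (?c r) ?z = 0"
    using assms by simp
  have "degree r < 2"
    unfolding r_def using degree_mod_less'[of ?d q] by (cases "q mod ?d = 0") auto
  then have "r = [:coeff r 0, coeff r 1:]"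
    by (intro poly_eqI) (auto simp: coeff_pCons coeff_eq_0 split: nat.split)
  then obtain s t where st: "r = [:s, t:]"
    by blast
  then have "r = 0"
    using r assms(2) by (auto simp: map_poly_pCons complex_eq_iff)
  then show ?thesis
    by (simp add: r_def dvd_eq_mod_eq_0)
qed

text \<open>Linear factors are split off one at a time by the fundamental theorem of algebra; a
  nonreal or repeated root leads to one of the first two cases, which minimality of an annihilating
  polynomial will exclude.\<close>

lemma real_poly_factor_cases:
  fixes q :: "real poly"
  assumes "q \<noteq> 0"
  obtains (quadratic) \<alpha> \<beta> where "\<beta> \<noteq> 0" "[:\<alpha>\<^sup>2 + \<beta>\<^sup>2, -2 * \<alpha>, 1:] dvd q"
    | (square) a where "[:-a, 1:]\<^sup>2 dvd q"
    | (split) c A where "c \<noteq> 0" "finite A" "q = smult c (\<Prod>a\<in>A. [:-a, 1:])"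
proof -
  have "(\<exists>\<alpha> \<beta>. \<beta> \<noteq> 0 \<and> [:\<alpha>\<^sup>2 + \<beta>\<^sup>2, -2 * \<alpha>, 1:] dvd q) \<or> (\<exists>a. [:-a, 1:]\<^sup>2 dvd q) \<or>
    (\<exists>c A. c \<noteq> 0 \<and> finite A \<and> q = smult c (\<Prod>a\<in>A. [:-a, 1:]))"
    using assms
  proof (induction "degree q" arbitrary: q)
    case 0
    then obtain c where "q = [:c:]"
      by (metis degree_eq_zeroE)
    with 0 have "c \<noteq> 0 \<and> finite {} \<and> q = smult c (\<Prod>a\<in>{}. [:-a, 1:])"
      by simp
    then show ?case
      by blast
  next
    case (Suc n)
    have "degree (map_poly complex_of_real q) = degree q"
      by (simp add: degree_map_poly)
    then have "\<not> constant (poly (map_poly complex_of_real q))"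
      by (simp add: constant_degree Suc.hyps(2)[symmetric])
    then obtain z where z: "poly (map_poly complex_of_real q) z = 0"
      using fundamental_theorem_of_algebra by blast
    show ?case
    proof (cases "Im z = 0")
      case False
      then show ?thesis
        using real_quadratic_factor[of q "Re z" "Im z"] z by auto
    next
      case True
      define a where "a = Re z"
      have "complex_of_real (poly q a) = poly (map_poly of_real q) (of_real a)"
        by (induction q) (simp_all add: map_poly_pCons)
      moreover have "complex_of_real a = z"
        using True by (simp add: a_def complex_eq_iff)
      ultimately have "poly q a = 0"
        using z by (metis of_real_eq_0_iff)
      then obtain h where h: "q = [:-a, 1:] * h"
        using poly_eq_0_iff_dvd[of q a] by (auto elim: dvdE)
      then have "h \<noteq> 0"
        using Suc.prems by auto
      then have "n = degree h"
        using Suc.hyps(2) degree_mult_eq[of "[:-a, 1:]" h] by (simp add: h del: mult_pCons_left)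
      from Suc.hyps(1)[OF this \<open>h \<noteq> 0\<close>] consider
        (1) \<alpha> \<beta> where "\<beta> \<noteq> 0" "[:\<alpha>\<^sup>2 + \<beta>\<^sup>2, -2 * \<alpha>, 1:] dvd h"
        | (2) b where "[:-b, 1:]\<^sup>2 dvd h"
        | (3) c A where "c \<noteq> 0" "finite A" "h = smult c (\<Prod>a\<in>A. [:-a, 1:])"
        by blast
      then show ?thesis
      proof cases
        case (3 c A)
        show ?thesis
        proof (cases "a \<in> A")
          case True
          then have "[:-a, 1:] dvd (\<Prod>a\<in>A. [:-a, 1:])"
            using 3 by (intro dvd_prodI)
          then have "[:-a, 1:] dvd h"
            by (simp add: 3 dvd_smult)
          then have "[:-a, 1:]\<^sup>2 dvd q"
            unfolding h power2_eq_square by (rule mult_dvd_mono[OF dvd_refl])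
          then show ?thesis
            by blast
        next
          case False
          then have "c \<noteq> 0 \<and> finite (insert a A) \<and> q = smult c (\<Prod>a\<in>insert a A. [:-a, 1:])"
            using 3 by (simp add: h)
          then show ?thesis
            by blast
        qed
      qed (use dvd_mult h in blast)+
    qed
  qed
  then show thesis
    using that by blast
qed

section \<open>Spectral decomposition\<close>

context euclidean_jordan begin

text \<open>A minimal annihilating polynomial has simple real roots only: by associativity of the inner
  product, \<open>u\<^sup>2 + v\<^sup>2 = 0\<close> forces \<open>u = v = 0\<close>.\<close>

lemma annihilating_poly_split:
  obtains A where "finite A" "ev (\<Prod>a\<in>A. [:-a, 1:]) x = 0"
proof -
  define Q where "Q = (\<lambda>q. q \<noteq> 0 \<and> ev q x = 0)"
  obtain q where "Q q" and q_min: "\<And>g. Q g \<Longrightarrow> degree q \<le> degree g"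
    using annihilating_poly_exists[of x] ex_has_least_nat[of Q _ degree] Q_def by metis
  then have q: "q \<noteq> 0" "ev q x = 0"
    by (auto simp: Q_def)
  from q(1) show thesis
  proof (cases rule: real_poly_factor_cases)
    case (quadratic \<alpha> \<beta>)
    then obtain g where g: "q = [:\<alpha>\<^sup>2 + \<beta>\<^sup>2, -2 * \<alpha>, 1:] * g"
      by (auto elim: dvdE)
    \<comment> \<open>Completing the square writes \<open>q * g\<close>, which annihilates
      \<open>x\<close> along with \<open>q\<close>, as a sum of two squares.\<close>
    have "([:-\<alpha>, 1:] * g) * ([:-\<alpha>, 1:] * g) + smult \<beta> g * smult \<beta> g =
        [:\<alpha>\<^sup>2 + \<beta>\<^sup>2, -2 * \<alpha>, 1:] * (g * g)"
      by (rule poly_ext) (simp add: power2_eq_square algebra_simps)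
    also have "\<dots> = q * g"
      by (simp only: g mult.assoc)
    finally have "ev ([:-\<alpha>, 1:] * g) x \<odot> ev ([:-\<alpha>, 1:] * g) x + ev (smult \<beta> g) x \<odot> ev (smult \<beta> g) x = 0"
      using q(2) by (metis ev_add ev_mult bilinear_lzero[OF bilinear_jp])
    then have "ev (smult \<beta> g) x = 0"
      by (rule sum_squares_eq_0)
    then have "Q g"
      using quadratic q g by (auto simp: Q_def ev_smult)
    moreover have "degree g < degree q"
      using q(1) unfolding g by (subst degree_mult_eq) auto
    ultimately show thesis
      using q_min[of g] by simp
  next
    case (square a)
    then obtain g where g: "q = [:-a, 1:]\<^sup>2 * g"
      by (auto elim: dvdE)
    \<comment> \<open>Here \<open>q * g\<close> is a single square; the zero summand brings it into
      the form of \<open>sum_squares_eq_0\<close>.\<close>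
    have "([:-a, 1:] * g) * ([:-a, 1:] * g) + 0 * 0 = q * g"
      by (simp only: g power2_eq_square mult_ac mult_zero_left add_0_right)
    then have "ev ([:-a, 1:] * g) x \<odot> ev ([:-a, 1:] * g) x + ev 0 x \<odot> ev 0 x = 0"
      using q(2) by (metis ev_add ev_mult bilinear_lzero[OF bilinear_jp])
    then have "ev ([:-a, 1:] * g) x = 0"
      by (rule sum_squares_eq_0)
    moreover have "[:-a, 1:] * g \<noteq> 0"
      using q(1) unfolding g by (metis mult_eq_0_iff pCons_eq_0_iff zero_neq_one)
    ultimately have "Q ([:-a, 1:] * g)"
      by (simp add: Q_def)
    moreover have "degree ([:-a, 1:] * g) < degree q"
      unfolding g power2_eq_square mult.assoc
      by (subst (2) degree_mult_eq) (use \<open>Q ([:-a, 1:] * g)\<close> in \<open>simp_all add: Q_def del: mult_pCons_left\<close>)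
    ultimately show thesis
      using q_min[of "[:-a, 1:] * g"] by simp
  next
    case (split c A)
    then have "ev (\<Prod>a\<in>A. [:-a, 1:]) x = 0"
      using q(2) by (simp add: ev_smult)
    with split that show thesis
      by blast
  qed
qed

text \<open>The idempotents are the values at \<open>x\<close> of the Lagrange polynomials of the spectrum.\<close>

lemma spectral_decomposition:
  "\<exists>A E. finite A \<and> (\<forall>a\<in>A. E a \<odot> E a = E a \<and> E a \<noteq> 0 \<and> (\<exists>q. E a = ev q x)) \<and>
     (\<forall>a\<in>A. \<forall>b\<in>A. a \<noteq> b \<longrightarrow> E a \<odot> E b = 0) \<and> (\<Sum>a\<in>A. E a) = e \<and> x = (\<Sum>a\<in>A. a *\<^sub>R E a)"
proof -
  obtain B where B: "finite B" "ev (\<Prod>a\<in>B. [:-a, 1:]) x = 0"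
    by (rule annihilating_poly_split)
  \<comment> \<open>\<open>ev f x\<close> depends only on the values of \<open>f\<close> on
    \<open>B\<close>, so the identities below are checked pointwise on \<open>B\<close>.\<close>
  have cong: "ev f x = ev g x" if "\<And>a. a \<in> B \<Longrightarrow> poly f a = poly g a" for f g
  proof -
    have "(\<Prod>a\<in>B. [:-a, 1:]) dvd f - g"
      by (rule linear_factors_dvd) (use B that in auto)
    then have "ev (f - g) x = 0"
      using B(2) by (auto elim!: dvdE simp: ev_mult jp_simps)
    then show ?thesis
      by (simp add: ev_diff)
  qed
  define L where "L a = (\<Prod>b\<in>B - {a}. smult (1 / (a - b)) [:-b, 1:])" for a
  have L: "poly (L a) c = (if c = a then 1 else 0)" if "a \<in> B" "c \<in> B" for a c
    using that B(1) by (auto simp: L_def poly_prod divide_simps intro!: prod.neutral prod_zero)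
  define E where "E a = ev (L a) x" for a
  \<comment> \<open>\<open>B\<close> may contain points outside the spectrum of \<open>x\<close>;
    their idempotents vanish and are dropped.\<close>
  define A where "A = {a\<in>B. E a \<noteq> 0}"
  have AB: "(\<Sum>a\<in>A. f a *\<^sub>R E a) = (\<Sum>a\<in>B. f a *\<^sub>R E a)" for f :: "real \<Rightarrow> real"
    by (rule sum.mono_neutral_left) (auto simp: A_def B(1))
  have EE: "E a \<odot> E b = (if a = b then E a else 0)" if "a \<in> B" "b \<in> B" for a b
  proof -
    have "ev (L a * L b) x = ev (if a = b then L a else 0) x"
      by (rule cong) (auto simp: L that)
    then show ?thesis
      by (auto simp: E_def ev_mult)
  qed
  have comb: "(\<Sum>a\<in>A. f a *\<^sub>R E a) = ev q x" if "\<And>a. a \<in> B \<Longrightarrow> poly q a = f a" for f q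
  proof -
    have "ev (\<Sum>a\<in>B. smult (f a) (L a)) x = ev q x"
      by (rule cong) (use B(1) in \<open>simp add: poly_sum L that if_distrib cong: if_cong\<close>)
    then show ?thesis
      unfolding AB by (simp add: E_def ev_sum ev_smult)
  qed
  show ?thesis
  proof (intro exI[of _ A] exI[of _ E] conjI)
    show "(\<Sum>a\<in>A. E a) = e"
      using comb[of 1 "\<lambda>_. 1"] by simp
    show "x = (\<Sum>a\<in>A. a *\<^sub>R E a)"
      using comb[of "[:0, 1:]" "\<lambda>a. a"] by simp
  qed (use EE B(1) in \<open>auto simp: A_def E_def\<close>)
qed

section \<open>Peirce theory of primitive idempotents\<close>

lemma idempotent_iff: "idempotent (\<odot>) c \<longleftrightarrow> c \<odot> c = c"
  by (simp add: idempotent_def)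

text \<open>With \<open>L\<close> for multiplication operators, the polarized identity at
  \<open>x\<close>, \<open>c\<close>, \<open>c\<close> reads [L(x), L(c)] = 2 [L(xc), L(c)]. Both
  for xc = x and for xc = 0 the commutator vanishes.\<close>

lemma peirce_operator_commute:
  assumes "c \<odot> c = c" "c \<odot> x = x \<or> c \<odot> x = 0"
  shows "c \<odot> (x \<odot> u) = x \<odot> (c \<odot> u)"
proof -
  have "x \<odot> (c \<odot> u) + (c \<odot> (x \<odot> c \<odot> u) + c \<odot> (x \<odot> c \<odot> u)) =
      c \<odot> (x \<odot> u) + (x \<odot> c \<odot> (c \<odot> u) + x \<odot> c \<odot> (c \<odot> u))"
    using linearized_jordan_identity[of x c c u] assms(1) by (simp add: add.assoc)
  moreover have "x \<odot> c = x \<or> x \<odot> c = 0"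
    using assms(2) jp_commute by metis
  ultimately show ?thesis
    by (auto simp: jp_simps)
qed

text \<open>For the multiplication \<open>L\<close> by \<open>c\<close>, the triple product formula
  gives 2L^3 - 3L^2 + L = 0. In this form it says that P(c) = 2L^2 - L maps into the Peirce
  one-space of \<open>c\<close>.\<close>

lemma peirce_cubic:
  assumes "c \<odot> c = c"
  shows "c \<odot> (2 *\<^sub>R c \<odot> (c \<odot> u) - c \<odot> u) = 2 *\<^sub>R c \<odot> (c \<odot> u) - c \<odot> u"
  using triple_product_operator[of c c c u] assms
  by (simp add: jp_simps scaleR_2 algebra_simps)

text \<open>A spectral idempotent of \<open>x\<close> with nonzero eigenvalue is a polynomial in
  \<open>x\<close> without constant term, so it lies in the Peirce one-space too. It would split
  \<open>c\<close> orthogonally, so by primitivity it equals \<open>c\<close>, and at most one such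
  eigenvalue occurs.\<close>

lemma primitive_peirce_one:
  assumes c: "primitive_idempotent (\<odot>) c" and x: "c \<odot> x = x"
  shows "\<exists>a. x = a *\<^sub>R c"
proof -
  have cc: "c \<odot> c = c" "c \<noteq> 0"
    using c by (auto simp: primitive_idempotent_def idempotent_iff)
  obtain A E where AE: "finite A \<and> (\<forall>a\<in>A. E a \<odot> E a = E a \<and> E a \<noteq> 0 \<and> (\<exists>q. E a = ev q x)) \<and>
     (\<forall>a\<in>A. \<forall>b\<in>A. a \<noteq> b \<longrightarrow> E a \<odot> E b = 0) \<and> (\<Sum>a\<in>A. E a) = e \<and> x = (\<Sum>a\<in>A. a *\<^sub>R E a)"
    using spectral_decomposition[of x] by blast
  then have A: "finite A" "\<And>a. a \<in> A \<Longrightarrow> E a \<odot> E a = E a" "\<And>a. a \<in> A \<Longrightarrow> E a \<noteq> 0"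
    "\<And>a b. a \<in> A \<Longrightarrow> b \<in> A \<Longrightarrow> a \<noteq> b \<Longrightarrow> E a \<odot> E b = 0" "(\<Sum>a\<in>A. E a) = e"
    "x = (\<Sum>a\<in>A. a *\<^sub>R E a)" "\<And>a. a \<in> A \<Longrightarrow> \<exists>q. E a = ev q x"
    by blast+
  have comm: "c \<odot> (x \<odot> u) = x \<odot> (c \<odot> u)" for u
    by (rule peirce_operator_commute) (use cc x in auto)
  have cev: "c \<odot> (x \<odot> ev q x) = x \<odot> ev q x" for q
  proof (induction q)
    case (pCons b q)
    then show ?case
      by (simp add: comm ev_pCons jp_simps x)
  qed (simp add: jp_simps)
  have E_eq: "E a = c" if a: "a \<in> A" "a \<noteq> 0" for a
  proof -
    have "x \<odot> E a = (\<Sum>b\<in>A. if b = a then a *\<^sub>R E a else 0)"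
      unfolding A(6) jp_sum_left by (rule sum.cong) (use A(2,4) a in \<open>auto simp: jp_simps\<close>)
    then have "x \<odot> E a = a *\<^sub>R E a"
      using a A(1) by simp
    moreover obtain q where "E a = ev q x"
      using A(7) a by blast
    ultimately have "c \<odot> E a = E a"
      using cev[of q] a(2) by (simp add: jp_simps)
    moreover from this have "E a \<odot> c = E a"
      by (simp add: jp_commute)
    ultimately have "idempotent (\<odot>) (E a)" "idempotent (\<odot>) (c - E a)" "E a \<odot> (c - E a) = 0"
      using A(2) a cc by (simp_all add: idempotent_iff jp_simps)
    moreover have "c = E a + (c - E a)"
      by simp
    ultimately have "c - E a = 0"
      using c A(3)[OF a(1)] unfolding primitive_idempotent_def by metis
    then show ?thesis
      by simp
  qed
  show ?thesis
  proof (cases "\<exists>a\<in>A. a \<noteq> 0")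
    case True
    then obtain a where a: "a \<in> A" "a \<noteq> 0" by blast
    have "b = 0" if "b \<in> A" "b \<noteq> a" for b
      using A(4)[OF that(1) a(1) that(2)] E_eq that a cc by metis
    then have "x = (\<Sum>b\<in>A. if b = a then a *\<^sub>R E a else 0)"
      unfolding A(6) by (intro sum.cong) auto
    then show ?thesis
      using a A(1) E_eq by auto
  next
    case False
    then have "x = 0 *\<^sub>R c"
      unfolding A(6) by (auto intro!: sum.neutral)
    then show ?thesis ..
  qed
qed

text \<open>\<open>P(c)d = 2c(cd) - cd\<close> is a multiple of \<open>c\<close>, and \<open>\<langle>d, P(c)d\<rangle> = 2\<langle>cd, cd\<rangle> - \<langle>c, d\<rangle>\<close> is
  symmetric in \<open>c\<close> and \<open>d\<close>.\<close>

lemma primitive_norm_eq: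
  assumes c: "primitive_idempotent (\<odot>) c" and d: "primitive_idempotent (\<odot>) d"
    and "ip c d \<noteq> 0"
  shows "ip c c = ip d d"
proof -
  \<comment> \<open>Pairing \<open>?P\<close>, a multiple of \<open>c\<close>, with \<open>c\<close>
    and with \<open>d\<close> and eliminating the scalar. The bracket is symmetric in
    \<open>c\<close> and \<open>d\<close>, and nonzero when \<open>ip c d\<close> is, so it
    cancels.\<close>
  have quad: "ip c c * (2 * ip (c \<odot> d) (c \<odot> d) - ip c d) = ip c d * ip c d"
    if c: "primitive_idempotent (\<odot>) c" and d: "primitive_idempotent (\<odot>) d" for c d
  proof -
    have cc: "c \<odot> c = c" "d \<odot> d = d"
      using c d by (auto simp: primitive_idempotent_def idempotent_iff)
    let ?P = "2 *\<^sub>R c \<odot> (c \<odot> d) - c \<odot> d"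
    obtain a where a: "?P = a *\<^sub>R c"
      using primitive_peirce_one[OF c peirce_cubic] cc by blast
    have cd: "ip c (c \<odot> u) = ip c u" for u
      using ip_assoc[of c c u] cc by simp
    have "ip c ?P = ip c d"
      by (simp add: ip_simps jp_simps cd)
    then have 1: "a * ip c c = ip c d"
      by (simp add: a ip_simps)
    have "ip d (c \<odot> d) = ip c d"
      by (metis cc(2) ip_assoc jp_commute ip_commute)
    moreover have "ip d (c \<odot> (c \<odot> d)) = ip (c \<odot> d) (c \<odot> d)"
      by (metis ip_assoc jp_commute)
    ultimately have "ip d ?P = 2 * ip (c \<odot> d) (c \<odot> d) - ip c d"
      by (simp add: ip_simps jp_simps)
    then have 2: "a * ip c d = 2 * ip (c \<odot> d) (c \<odot> d) - ip c d"
      by (simp add: a ip_simps ip_commute)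
    show ?thesis
      using 1 2 by (metis mult.assoc mult.commute)
  qed
  have "ip c c * (2 * ip (c \<odot> d) (c \<odot> d) - ip c d) = ip d d * (2 * ip (c \<odot> d) (c \<odot> d) - ip c d)"
    using quad[OF c d] quad[OF d c] by (simp add: jp_commute[of d c] ip_commute[of d c])
  moreover have "2 * ip (c \<odot> d) (c \<odot> d) - ip c d \<noteq> 0"
    using quad[OF c d] assms(3) by auto
  ultimately show ?thesis
    by simp
qed

text \<open>A Jordan frame without completeness. Subfamilies inherit the property, so multiplicities
  of single eigenvalues can be compared through it.\<close>

definition orthogonal_primitives :: "'a set \<Rightarrow> bool" where
  "orthogonal_primitives C \<longleftrightarrow> finite C \<and> (\<forall>c\<in>C. primitive_idempotent (\<odot>) c) \<and>
     (\<forall>c\<in>C. \<forall>d\<in>C. c \<noteq> d \<longrightarrow> c \<odot> d = 0)"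

lemma orthogonal_primitives_mult:
  "orthogonal_primitives C \<Longrightarrow> c \<in> C \<Longrightarrow> d \<in> C \<Longrightarrow> c \<odot> d = (if c = d then c else 0)"
  by (auto simp: orthogonal_primitives_def primitive_idempotent_def idempotent_iff)

lemma orthogonal_primitives_subset:
  "orthogonal_primitives C \<Longrightarrow> D \<subseteq> C \<Longrightarrow> orthogonal_primitives D"
  using finite_subset by (auto simp: orthogonal_primitives_def subset_eq)

text \<open>Double counting with the weights \<open>\<langle>c, d\<rangle> / \<langle>c, c\<rangle> = \<langle>c, d\<rangle> / \<langle>d, d\<rangle>\<close>, whose row and column
  sums are all \<open>1\<close>.\<close>

lemma orthogonal_primitives_card_eq:
  assumes C: "orthogonal_primitives C" and D: "orthogonal_primitives D" and "\<Sum>C = \<Sum>D"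
  shows "card C = card D"
proof -
  have row: "(\<Sum>d\<in>D. ip c d / ip c c) = 1"
    if C: "orthogonal_primitives C" "c \<in> C" and "\<Sum>C = \<Sum>D" for c C D
  proof -
    have "ip c (\<Sum>D) = (\<Sum>d\<in>C. ip c d)"
      by (simp add: ip_sum_right flip: that(3))
    also have "\<dots> = (\<Sum>d\<in>C. if d = c then ip c c else 0)"
    proof (rule sum.cong)
      fix d assume "d \<in> C"
      have "ip c d = ip c (c \<odot> d)"
        using orthogonal_primitives_mult[OF C(1) C(2) C(2)] ip_assoc[of c c d] by simp
      then show "ip c d = (if d = c then ip c c else 0)"
        using orthogonal_primitives_mult[OF C(1) C(2) \<open>d \<in> C\<close>] by (auto simp: ip_simps)
    qed simp
    also have "\<dots> = ip c c"
      using C by (simp add: orthogonal_primitives_def)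
    finally have "(\<Sum>d\<in>D. ip c d) = ip c c"
      by (simp add: ip_sum_right)
    moreover have "ip c c \<noteq> 0"
      using C by (auto simp: ip_eq_0_iff orthogonal_primitives_def primitive_idempotent_def)
    ultimately show ?thesis
      by (simp flip: sum_divide_distrib)
  qed
  have "real (card C) = (\<Sum>c\<in>C. \<Sum>d\<in>D. ip c d / ip c c)"
    using row[OF C _ assms(3)] by simp
  also have "\<dots> = (\<Sum>c\<in>C. \<Sum>d\<in>D. ip d c / ip d d)"
  proof (intro sum.cong refl)
    fix c d assume "c \<in> C" "d \<in> D"
    then show "ip c d / ip c c = ip d c / ip d d"
      using primitive_norm_eq[of c d] C D ip_commute[of c d]
      by (cases "ip c d = 0") (auto simp: orthogonal_primitives_def)
  qed
  also have "\<dots> = (\<Sum>d\<in>D. \<Sum>c\<in>C. ip d c / ip d d)"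
    by (rule sum.swap)
  also have "\<dots> = real (card D)"
    using row[OF D _ assms(3)[symmetric]] by simp
  finally show ?thesis
    by simp
qed

section \<open>Jordan frames, rank and eigenvalues\<close>

lemma jordan_frame_iff: "jordan_frame (\<odot>) e C \<longleftrightarrow> orthogonal_primitives C \<and> \<Sum>C = e"
  by (auto simp: jordan_frame_def orthogonal_primitives_def)

lemma orthogonal_idempotents_card_le:
  assumes "finite C" "\<And>c. c \<in> C \<Longrightarrow> c \<odot> c = c" "\<And>c. c \<in> C \<Longrightarrow> c \<noteq> 0"
    "\<And>c d. c \<in> C \<Longrightarrow> d \<in> C \<Longrightarrow> c \<noteq> d \<Longrightarrow> c \<odot> d = 0"
  shows "card C \<le> DIM('a)"
proof -
  have "independent C"
  proof (rule independent_if_scalars_zero[OF assms(1)])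
    fix f c assume f: "(\<Sum>x\<in>C. f x *\<^sub>R x) = 0" and c: "c \<in> C"
    have "c \<odot> (\<Sum>x\<in>C. f x *\<^sub>R x) = (\<Sum>x\<in>C. if x = c then f c *\<^sub>R c else 0)"
      unfolding jp_sum_right by (rule sum.cong) (use assms c in \<open>auto simp: jp_simps\<close>)
    then show "f c = 0"
      using f c assms by (simp add: jp_simps)
  qed
  then show ?thesis
    by (simp add: independent_bound)
qed

text \<open>A decomposition of \<open>x\<close> over a family of orthogonal idempotents with the largest possible
  number of members is a decomposition over a frame.\<close>

lemma frame_decomposition_exists:
  obtains C l where "jordan_frame (\<odot>) e C" "x = (\<Sum>c\<in>C. l c *\<^sub>R c)"
proof -
  define Q where "Q C \<longleftrightarrow> finite C \<and> (\<forall>c\<in>C. c \<odot> c = c \<and> c \<noteq> 0) \<and>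
    (\<forall>c\<in>C. \<forall>d\<in>C. c \<noteq> d \<longrightarrow> c \<odot> d = 0) \<and> \<Sum>C = e \<and> (\<exists>l. x = (\<Sum>c\<in>C. l c *\<^sub>R c))" for C
  obtain A E where AE: "finite A \<and> (\<forall>a\<in>A. E a \<odot> E a = E a \<and> E a \<noteq> 0 \<and> (\<exists>q. E a = ev q x)) \<and>
     (\<forall>a\<in>A. \<forall>b\<in>A. a \<noteq> b \<longrightarrow> E a \<odot> E b = 0) \<and> (\<Sum>a\<in>A. E a) = e \<and> x = (\<Sum>a\<in>A. a *\<^sub>R E a)"
    using spectral_decomposition[of x] by blast
  then have A: "finite A" "\<And>a. a \<in> A \<Longrightarrow> E a \<odot> E a = E a" "\<And>a. a \<in> A \<Longrightarrow> E a \<noteq> 0"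
    "\<And>a b. a \<in> A \<Longrightarrow> b \<in> A \<Longrightarrow> a \<noteq> b \<Longrightarrow> E a \<odot> E b = 0" "(\<Sum>a\<in>A. E a) = e"
    "x = (\<Sum>a\<in>A. a *\<^sub>R E a)" "\<And>a. a \<in> A \<Longrightarrow> \<exists>q. E a = ev q x"
    by blast+
  have inj: "inj_on E A"
  proof (rule inj_onI, rule ccontr)
    fix a b assume "a \<in> A" "b \<in> A" "E a = E b" "a \<noteq> b"
    then show False
      using A(2)[of a] A(3)[of a] A(4)[of a b] by simp
  qed
  have "Q (E ` A)"
    unfolding Q_def
  proof (intro conjI exI[of _ "inv_into A E"])
    show "x = (\<Sum>c\<in>E ` A. inv_into A E c *\<^sub>R c)"
      unfolding sum.reindex[OF inj] comp_def
      by (subst A(6), rule sum.cong) (auto simp: inv_into_f_f[OF inj])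
  qed (use A inj in \<open>auto simp: sum.reindex\<close>)
  moreover have "\<forall>C. Q C \<longrightarrow> card C < Suc (DIM('a))"
    using orthogonal_idempotents_card_le by (auto simp: Q_def less_Suc_eq_le)
  ultimately obtain C where C: "Q C" and max: "\<And>D. Q D \<Longrightarrow> card D \<le> card C"
    using ex_has_greatest_nat[of Q "E ` A" card "Suc (DIM('a))"] by blast
  then obtain l where l: "x = (\<Sum>c\<in>C. l c *\<^sub>R c)"
    by (auto simp: Q_def)
  have CC: "finite C" "\<And>c. c \<in> C \<Longrightarrow> c \<odot> c = c" "\<And>c. c \<in> C \<Longrightarrow> c \<noteq> 0"
    "\<And>c d. c \<in> C \<Longrightarrow> d \<in> C \<Longrightarrow> c \<noteq> d \<Longrightarrow> c \<odot> d = 0" "\<Sum>C = e"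
    using C by (auto simp: Q_def)
  have "primitive_idempotent (\<odot>) c" if c: "c \<in> C" for c
    unfolding primitive_idempotent_def idempotent_iff
  proof (intro conjI notI CC c)
    assume "\<exists>c1 c2. c1 \<odot> c1 = c1 \<and> c2 \<odot> c2 = c2 \<and> c1 \<noteq> 0 \<and> c2 \<noteq> 0 \<and> c1 \<odot> c2 = 0 \<and> c = c1 + c2"
    then obtain c1 c2 where s: "c1 \<odot> c1 = c1" "c2 \<odot> c2 = c2" "c1 \<noteq> 0" "c2 \<noteq> 0" "c1 \<odot> c2 = 0"
      "c = c1 + c2"
      by blast
    have s': "c2 \<odot> c1 = 0"
      using s(5) jp_commute by metis
    \<comment> \<open>The pieces of \<open>c\<close> stay orthogonal to the other members:
      \<open>d\<close> lies in the Peirce zero-space and \<open>c'\<close> in the one-space of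
      \<open>c\<close>, so by commutation c(dc') equals both dc' and 0.\<close>
    have orth: "c' \<odot> d = 0" "d \<odot> c' = 0" if d: "d \<in> C - {c}" and c': "c' = c1 \<or> c' = c2" for c' d
    proof -
      have "c \<odot> d = 0"
        using CC(4) c d by blast
      moreover have "c \<odot> c' = c'"
        using c' s s' by (auto simp: jp_simps)
      moreover have "c \<odot> (d \<odot> c') = d \<odot> (c \<odot> c')" "c \<odot> (c' \<odot> d) = c' \<odot> (c \<odot> d)"
        using calculation CC(2)[OF c] by (intro peirce_operator_commute; simp)+
      ultimately show "d \<odot> c' = 0" "c' \<odot> d = 0"
        by (simp_all add: jp_commute[of c' d] jp_simps)
    qed
    have notin: "c1 \<notin> C - {c}" "c2 \<notin> C - {c}" "c1 \<noteq> c2"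
      using orth s by metis+
    define l' where "l' d = (if d = c1 \<or> d = c2 then l c else l d)" for d
    let ?D = "insert c1 (insert c2 (C - {c}))"
    have sums: "(\<Sum>d\<in>?D. f d) = f c1 + (f c2 + (\<Sum>d\<in>C - {c}. f d))" for f :: "'a \<Rightarrow> 'a"
      using notin CC(1) by (subst sum.insert; force)+
    have "Q ?D"
      unfolding Q_def
    proof (intro conjI exI[of _ l'])
      show "\<Sum>?D = e"
        using CC(5) s(6) unfolding sums by (simp add: sum.remove[OF CC(1) c] add.assoc)
      have "(\<Sum>d\<in>C - {c}. l' d *\<^sub>R d) = (\<Sum>d\<in>C - {c}. l d *\<^sub>R d)"
        using notin by (intro sum.cong) (auto simp: l'_def)
      then show "x = (\<Sum>d\<in>?D. l' d *\<^sub>R d)"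
        unfolding sums by (simp add: l l'_def sum.remove[OF CC(1) c] s(6) scaleR_add_right add.assoc)
      show "\<forall>c\<in>?D. \<forall>d\<in>?D. c \<noteq> d \<longrightarrow> c \<odot> d = 0"
        using orth s(5) s' CC(4) by auto
    qed (use CC s in auto)
    then have "card ?D \<le> card C"
      by (rule max)
    moreover have "card ?D = Suc (Suc (card (C - {c})))"
      using notin CC(1) by simp
    moreover have "card C = Suc (card (C - {c}))"
      using CC(1) c by (metis card.remove)
    ultimately show False
      by simp
  qed (use CC(3) c in simp)
  then have "jordan_frame (\<odot>) e C"
    using CC by (auto simp: jordan_frame_def)
  then show thesis
    using that l by blast
qed

lemma ev_frame:
  assumes C: "jordan_frame (\<odot>) e C" and x: "x = (\<Sum>c\<in>C. l c *\<^sub>R c)"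
  shows "ev q x = (\<Sum>c\<in>C. poly q (l c) *\<^sub>R c)"
proof (induction q)
  case (pCons a q)
  have C': "orthogonal_primitives C" "finite C" "\<Sum>C = e"
    using C by (auto simp: jordan_frame_iff orthogonal_primitives_def)
  have "x \<odot> ev q x = (\<Sum>c\<in>C. \<Sum>d\<in>C. l c *\<^sub>R c \<odot> (poly q (l d) *\<^sub>R d))"
    using pCons x jp_sum_left[of "\<lambda>c. l c *\<^sub>R c" C "ev q x"] by (simp add: jp_sum_right)
  also have "\<dots> = (\<Sum>c\<in>C. (l c * poly q (l c)) *\<^sub>R c)"
  proof (rule sum.cong)
    fix c assume c: "c \<in> C"
    have "(\<Sum>d\<in>C. l c *\<^sub>R c \<odot> (poly q (l d) *\<^sub>R d)) =
        (\<Sum>d\<in>C. if d = c then (l c * poly q (l c)) *\<^sub>R c else 0)"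
      by (rule sum.cong) (use orthogonal_primitives_mult[OF C'(1) c] in \<open>auto simp: jp_simps\<close>)
    then show "(\<Sum>d\<in>C. l c *\<^sub>R c \<odot> (poly q (l d) *\<^sub>R d)) = (l c * poly q (l c)) *\<^sub>R c"
      using c C' by simp
  qed simp
  finally show ?case
    by (simp add: ev_pCons scaleR_add_left sum.distrib scaleR_sum_right[symmetric] C')
qed simp

lemma frame_combination_eq_0_iff:
  assumes C: "orthogonal_primitives C"
  shows "(\<Sum>c\<in>C. f c *\<^sub>R c) = 0 \<longleftrightarrow> (\<forall>c\<in>C. f c = 0)"
proof
  assume f: "(\<Sum>c\<in>C. f c *\<^sub>R c) = 0"
  show "\<forall>c\<in>C. f c = 0"
  proof
    fix c assume c: "c \<in> C"
    have "c \<odot> (\<Sum>x\<in>C. f x *\<^sub>R x) = (\<Sum>x\<in>C. if x = c then f c *\<^sub>R c else 0)"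
      unfolding jp_sum_right
      by (rule sum.cong) (use orthogonal_primitives_mult[OF C c] in \<open>auto simp: jp_simps\<close>)
    then show "f c = 0"
      using f c C by (auto simp: jp_simps orthogonal_primitives_def primitive_idempotent_def)
  qed
qed simp

text \<open>By \<open>ev_frame\<close> and the independence of the frame, the annihilating
  polynomials are exactly the multiples of the product of linear factors over the distinct values of
  \<open>l\<close>.\<close>

lemma degree_jordan_minpoly:
  assumes C: "jordan_frame (\<odot>) e C" and x: "x = (\<Sum>c\<in>C. l c *\<^sub>R c)"
  shows "degree (jordan_minpoly (\<odot>) e x) = card (l ` C)"
proof -
  have "orthogonal_primitives C" "finite C"
    using C by (auto simp: jordan_frame_iff orthogonal_primitives_def)
  define P where "P = (\<Prod>a\<in>l ` C. [:-a, 1:])"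
  have P: "degree P = card (l ` C)"
    unfolding P_def by (simp add: degree_prod_sum_eq)
  have P1: "lead_coeff P = 1"
    unfolding P_def lead_coeff_prod by simp
  have ann: "ev q x = 0 \<longleftrightarrow> P dvd q" for q
  proof -
    have "ev q x = 0 \<longleftrightarrow> (\<forall>c\<in>C. poly q (l c) = 0)"
      unfolding ev_frame[OF C x] using \<open>orthogonal_primitives C\<close> by (rule frame_combination_eq_0_iff)
    also have "\<dots> \<longleftrightarrow> P dvd q"
    proof
      show "P dvd q" if "\<forall>c\<in>C. poly q (l c) = 0"
        unfolding P_def by (rule linear_factors_dvd) (use that \<open>finite C\<close> in auto)
      show "\<forall>c\<in>C. poly q (l c) = 0" if "P dvd q"
        using that \<open>finite C\<close> unfolding P_def by (auto elim!: dvdE simp: poly_prod)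
    qed
    finally show ?thesis .
  qed
  have "jordan_minpoly (\<odot>) e x = P"
    unfolding jordan_minpoly_def
  proof (rule the_equality)
    show "lead_coeff P = 1 \<and> ev P x = 0 \<and> (\<forall>q'. q' \<noteq> 0 \<and> ev q' x = 0 \<longrightarrow> degree P \<le> degree q')"
      using P1 by (auto simp: ann dvd_imp_degree_le)
    fix q assume q: "lead_coeff q = 1 \<and> ev q x = 0 \<and> (\<forall>q'. q' \<noteq> 0 \<and> ev q' x = 0 \<longrightarrow> degree q \<le> degree q')"
    then have "P dvd q"
      using ann by blast
    then obtain g where g: "q = P * g"
      by (rule dvdE)
    have "P \<noteq> 0"
      using P1 by auto
    moreover have "g \<noteq> 0"
      using q g by auto
    moreover have "degree q \<le> degree P"
      using q \<open>P \<noteq> 0\<close> by (auto simp: ann)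
    ultimately have "degree g = 0"
      by (simp add: g degree_mult_eq)
    then obtain a where "g = [:a:]"
      by (metis degree_eq_zeroE)
    then have "q = smult a P"
      by (simp add: g)
    moreover have "a = 1"
      using q P1 \<open>q = smult a P\<close> by (metis lead_coeff_smult mult.right_neutral)
    ultimately show "q = P"
      by simp
  qed
  with P show ?thesis
    by simp
qed

lemma frame_card_eq:
  "jordan_frame (\<odot>) e C \<Longrightarrow> jordan_frame (\<odot>) e D \<Longrightarrow> card C = card D"
  using orthogonal_primitives_card_eq by (simp add: jordan_frame_iff)

lemma jordan_rank_eq_card:
  assumes C: "jordan_frame (\<odot>) e C"
  shows "jordan_rank (\<odot>) e = card C"
proof -
  have le: "degree (jordan_minpoly (\<odot>) e x) \<le> card C" for x
  proof -
    obtain D l where D: "jordan_frame (\<odot>) e D" "x = (\<Sum>c\<in>D. l c *\<^sub>R c)"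
      by (rule frame_decomposition_exists)
    then have "degree (jordan_minpoly (\<odot>) e x) \<le> card D"
      by (simp add: degree_jordan_minpoly jordan_frame_def card_image_le)
    then show ?thesis
      using frame_card_eq[OF C D(1)] by simp
  qed
  have "finite C"
    using C by (simp add: jordan_frame_def)
  \<comment> \<open>Pairwise distinct coefficients yield an element whose minimal polynomial attains
    the bound.\<close>
  then obtain l :: "'a \<Rightarrow> nat" where "inj_on l C"
    using finite_imp_inj_to_nat_seg by blast
  then have "inj_on (real \<circ> l) C"
    by (simp add: inj_on_def)
  then have "degree (jordan_minpoly (\<odot>) e (\<Sum>c\<in>C. (real \<circ> l) c *\<^sub>R c)) = card C"
    by (subst degree_jordan_minpoly[OF C refl]) (rule card_image)
  then have "card C \<in> range (\<lambda>x. degree (jordan_minpoly (\<odot>) e x))"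
    by (metis rangeI)
  moreover have "finite (range (\<lambda>x. degree (jordan_minpoly (\<odot>) e x)))"
    using le by (auto intro: finite_subset[of _ "{..card C}"])
  ultimately show ?thesis
    unfolding jordan_rank_def by (intro Max_eqI) (use le in auto)
qed

text \<open>The frame members with eigenvalue \<open>v\<close> sum to the value at \<open>x\<close>
  of one interpolation polynomial, whichever frame is used. Orthogonal primitive families with equal
  sums have equal size, so multiplicities agree.\<close>

lemma jordan_eigenvalues_frame:
  assumes C: "jordan_frame (\<odot>) e C" and x: "x = (\<Sum>c\<in>C. l c *\<^sub>R c)"
  shows "jordan_eigenvalues (\<odot>) e x = image_mset l (mset_set C)"
  unfolding jordan_eigenvalues_def
proof (rule the_equality)
  show "\<exists>C' l'. jordan_frame (\<odot>) e C' \<and> card C' = jordan_rank (\<odot>) e \<and>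
      x = (\<Sum>c\<in>C'. l' c *\<^sub>R c) \<and> image_mset l (mset_set C) = image_mset l' (mset_set C')"
    using C x jordan_rank_eq_card[OF C] by metis
  fix L assume "\<exists>C l. jordan_frame (\<odot>) e C \<and> card C = jordan_rank (\<odot>) e \<and>
      x = (\<Sum>c\<in>C. l c *\<^sub>R c) \<and> L = image_mset l (mset_set C)"
  then obtain D k where D: "jordan_frame (\<odot>) e D" "x = (\<Sum>c\<in>D. k c *\<^sub>R c)"
    and L: "L = image_mset k (mset_set D)"
    by blast
  have fin: "finite C" "finite D"
    using C D by (auto simp: jordan_frame_def)
  have "card {d\<in>D. k d = v} = card {c\<in>C. l c = v}" for v
  proof -
    define q where "q = (\<Prod>b\<in>l ` C \<union> k ` D - {v}. smult (1 / (v - b)) [:-b, 1:])"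
    have q: "poly q b = (if b = v then 1 else 0)" if "b \<in> l ` C \<union> k ` D" for b
      using that fin by (auto simp: q_def poly_prod divide_simps intro!: prod.neutral prod_zero)
    have "\<Sum>{d\<in>D. k d = v} = ev q x"
      unfolding ev_frame[OF D] using fin q
      by (subst sum.inter_filter) (auto intro!: sum.cong)
    also have "\<dots> = \<Sum>{c\<in>C. l c = v}"
      unfolding ev_frame[OF C x] using fin q
      by (subst sum.inter_filter) (auto intro!: sum.cong)
    finally show ?thesis
      using C D by (intro orthogonal_primitives_card_eq)
        (auto simp: jordan_frame_iff intro: orthogonal_primitives_subset)
  qed
  moreover have "count (image_mset f (mset_set A)) v = card {a\<in>A. f a = v}"
    if "finite A" for f :: "'a \<Rightarrow> real" and A v
  proof -
    have "count (image_mset f (mset_set A)) v = (\<Sum>x\<in>{a\<in>A. f a = v}. 1)"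
      unfolding count_image_mset' by (rule sum.cong) (use that in auto)
    then show ?thesis
      by simp
  qed
  ultimately show "L = image_mset l (mset_set C)"
    unfolding L using fin by (intro multiset_eqI) simp
qed

lemma jordan_trace_frame:
  assumes "jordan_frame (\<odot>) e C" "x = (\<Sum>c\<in>C. l c *\<^sub>R c)"
  shows "jordan_trace (\<odot>) e x = (\<Sum>c\<in>C. l c)"
  by (simp add: jordan_trace_def jordan_eigenvalues_frame[OF assms] sum_unfold_sum_mset)

lemma jordan_det_frame:
  assumes "jordan_frame (\<odot>) e C" "x = (\<Sum>c\<in>C. l c *\<^sub>R c)"
  shows "jordan_det (\<odot>) e x = (\<Prod>c\<in>C. l c)"
  by (simp add: jordan_det_def jordan_eigenvalues_frame[OF assms] prod_unfold_prod_mset)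

lemma symmetric_cone_frame:
  assumes "jordan_frame (\<odot>) e C" "x = (\<Sum>c\<in>C. l c *\<^sub>R c)"
  shows "x \<in> symmetric_cone (\<odot>) e \<longleftrightarrow> (\<forall>c\<in>C. l c > 0)"
  using assms(1) by (simp add: symmetric_cone_def jordan_eigenvalues_frame[OF assms] jordan_frame_def)

end

subsection \<open>Hyperbolic polynomials\<close>

lemma poly_eq_on_infinite:
  fixes f g :: "'b::idom poly"
  assumes "infinite S" "\<And>z. z \<in> S \<Longrightarrow> poly f z = poly g z"
  shows "f = g"
proof (rule ccontr)
  assume "f \<noteq> g"
  then have "finite {z. poly (f - g) z = 0}"
    by (intro poly_roots_finite) simp
  moreover have "S \<subseteq> {z. poly (f - g) z = 0}"
    using assms(2) by auto
  ultimately show False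
    using assms(1) finite_subset by blast
qed

lemma poly_eq_on_reals:
  fixes f g :: "complex poly"
  assumes "\<And>t::real. poly f (of_real t) = poly g (of_real t)"
  shows "f = g"
proof (rule poly_eq_on_infinite)
  show "infinite (range complex_of_real)"
    using finite_imageD[of complex_of_real UNIV] infinite_UNIV_char_0[where 'a = real]
    by (auto simp: inj_def)
qed (use assms in auto)

text \<open>Up to a power of \<open>z\<close>, \<open>q\<close> is the reversal of \<open>g\<close>,
  whose degree does not drop because \<open>g\<close> is nonzero at 0. Restrictions of homogeneous
  polynomials to lines have this form.\<close>

lemma poly_reversal_degree:
  fixes q g :: "complex poly"
  assumes "\<And>z. z \<noteq> 0 \<Longrightarrow> poly q z = z ^ m * poly g (inverse z)" and "poly g 0 \<noteq> 0"
  shows "degree q = m" "lead_coeff q = poly g 0"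
proof -
  have eq: "monom 1 (degree g) * q = monom 1 m * reflect_poly g"
  proof (rule poly_eq_on_infinite)
    show "infinite (- {0 :: complex})"
      by (simp add: infinite_UNIV_char_0 flip: finite_Diff_insert)
  qed (simp add: assms(1) poly_monom poly_reflect_poly_nz)
  have g0: "coeff g 0 \<noteq> 0"
    using assms(2) by (simp add: poly_0_coeff_0)
  then have "g \<noteq> 0"
    by auto
  then have "q \<noteq> 0"
    using eq by auto
  have "degree g + degree q = m + degree g"
    using arg_cong[OF eq, of degree] \<open>q \<noteq> 0\<close> \<open>g \<noteq> 0\<close> g0
    by (simp add: degree_mult_eq degree_monom_eq)
  then show "degree q = m"
    by simp
  show "lead_coeff q = poly g 0"
    using arg_cong[OF eq, of lead_coeff] g0
    by (simp add: lead_coeff_mult degree_monom_eq coeff_reflect_poly poly_0_coeff_0)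
qed

text \<open>Roots all at distance at least \<eta> from \<open>z0\<close> would bound the factored
  value at \<open>z0\<close> from below. This is the continuity of roots needed for Garding's
  theorem.\<close>

lemma poly_root_near:
  fixes q :: "complex poly"
  assumes "\<eta> > 0" "norm (poly q z0) < norm (lead_coeff q) * \<eta> ^ degree q"
  shows "\<exists>z. poly q z = 0 \<and> norm (z0 - z) < \<eta>"
proof (rule ccontr)
  assume *: "\<not> ?thesis"
  have "q \<noteq> 0"
    using assms by auto
  have "\<eta> ^ size A \<le> norm (\<Prod>z\<in>#A. z0 - z)" if "\<And>z. z \<in># A \<Longrightarrow> norm (z0 - z) \<ge> \<eta>" for A
    using that
  proof (induction A)
    case (add z A)
    then show ?case
      using assms(1) by (auto simp: norm_mult intro!: mult_mono)
  qed simp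
  then have "\<eta> ^ size (proots q) \<le> norm (\<Prod>z\<in>#proots q. z0 - z)"
    using * \<open>q \<noteq> 0\<close> by (force simp: not_less)
  moreover have "poly q z0 = lead_coeff q * (\<Prod>z\<in>#proots q. z0 - z)"
    by (subst complex_poly_decompose_multiset[of q, symmetric])
      (simp add: poly_prod_mset image_mset.compositionality comp_def)
  ultimately have "norm (poly q z0) \<ge> norm (lead_coeff q) * \<eta> ^ degree q"
    by (simp add: norm_mult size_proots_complex mult_left_mono)
  then show False
    using assms(2) by simp
qed

text \<open>The logarithmic derivative at \<open>0\<close> is the sum of the \<open>- 1 / z\<close> over the roots \<open>z\<close>.\<close>

lemma Im_log_derivative_nonpos:
  fixes q :: "complex poly"
  assumes "poly q 0 \<noteq> 0" "\<And>z. poly q z = 0 \<Longrightarrow> Im z \<le> 0"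
  shows "Im (poly (pderiv q) 0 / poly q 0) \<le> 0"
proof -
  have "q \<noteq> 0"
    using assms(1) by auto
  let ?P = "\<lambda>A. \<Prod>z\<in>#A. [:-z, 1:] :: complex poly"
  have main: "poly (?P A) 0 \<noteq> 0 \<and> Im (poly (pderiv (?P A)) 0 / poly (?P A) 0) \<le> 0"
    if "\<And>z. z \<in># A \<Longrightarrow> z \<noteq> 0 \<and> Im z \<le> 0" for A
    using that
  proof (induction A)
    case (add z A)
    then have z: "z \<noteq> 0" "Im z \<le> 0" and A: "poly (?P A) 0 \<noteq> 0"
        "Im (poly (pderiv (?P A)) 0 / poly (?P A) 0) \<le> 0"
      by auto
    have "poly (pderiv (?P (add_mset z A))) 0 / poly (?P (add_mset z A)) 0 =
        poly (pderiv (?P A)) 0 / poly (?P A) 0 - 1 / z"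
      using z A by (simp add: pderiv_mult pderiv_pCons field_simps del: mult_pCons_left)
    moreover have "Im (1 / z) \<ge> 0"
      using z(2) by (simp add: Im_divide divide_nonpos_nonneg)
    ultimately show ?case
      using z A by simp
  qed simp
  have "poly (?P (proots q)) 0 \<noteq> 0 \<and>
      Im (poly (pderiv (?P (proots q))) 0 / poly (?P (proots q)) 0) \<le> 0"
    by (rule main) (use assms \<open>q \<noteq> 0\<close> in auto)
  moreover have "poly (pderiv (smult c P)) 0 / poly (smult c P) 0 = poly (pderiv P) 0 / poly P 0"
    if "c \<noteq> 0" for c and P :: "complex poly"
    using that by (simp add: pderiv_smult)
  then have "poly (pderiv q) 0 / poly q 0 = poly (pderiv (?P (proots q))) 0 / poly (?P (proots q)) 0"
    using complex_poly_decompose_multiset[of q] \<open>q \<noteq> 0\<close> by (metis leading_coeff_0_iff)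
  ultimately show ?thesis
    by simp
qed

section \<open>Complexification of polynomial functions\<close>

text \<open>A pair \<open>(x, y)\<close> stands for the vector \<open>x + iy\<close> of the complexified space.\<close>

definition cscale :: "complex \<Rightarrow> 'a::real_vector \<times> 'a \<Rightarrow> 'a \<times> 'a" (infixr "*\<^sub>C" 75) where
  "z *\<^sub>C w = (Re z *\<^sub>R fst w - Im z *\<^sub>R snd w, Im z *\<^sub>R fst w + Re z *\<^sub>R snd w)"

lemma cscale_pair: "z *\<^sub>C (x, y) = (Re z *\<^sub>R x - Im z *\<^sub>R y, Im z *\<^sub>R x + Re z *\<^sub>R y)"
  by (simp add: cscale_def)

lemma cscale_add_right: "z *\<^sub>C (v + w) = z *\<^sub>C v + z *\<^sub>C w"
  by (simp add: cscale_def prod_eq_iff algebra_simps)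

lemma cscale_cscale: "z *\<^sub>C y *\<^sub>C w = (z * y) *\<^sub>C w"
  by (simp add: cscale_def prod_eq_iff algebra_simps)

lemma cscale_simps [simp]: "0 *\<^sub>C w = 0" "1 *\<^sub>C w = w"
  by (simp_all add: cscale_def prod_eq_iff)

lemma continuous_on_cscale [continuous_intros]:
  fixes g :: "'c::topological_space \<Rightarrow> 'a::real_normed_vector \<times> 'a"
  assumes "continuous_on S f" "continuous_on S g"
  shows "continuous_on S (\<lambda>t. f t *\<^sub>C g t)"
  unfolding cscale_def using assms by (intro continuous_intros)

text \<open>The relation follows the formation rules of \<open>real_polynomial_function\<close>, so
  facts about the extension go by rule induction on both functions at once.\<close>

inductive complexification ::
    "('a::real_normed_vector \<Rightarrow> real) \<Rightarrow> ('a \<times> 'a \<Rightarrow> complex) \<Rightarrow> bool" where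
  linear: "bounded_linear f \<Longrightarrow> complexification f (\<lambda>w. Complex (f (fst w)) (f (snd w)))"
| const: "complexification (\<lambda>_. c) (\<lambda>_. of_real c)"
| add: "complexification f F \<Longrightarrow> complexification g G \<Longrightarrow>
    complexification (\<lambda>x. f x + g x) (\<lambda>w. F w + G w)"
| mult: "complexification f F \<Longrightarrow> complexification g G \<Longrightarrow>
    complexification (\<lambda>x. f x * g x) (\<lambda>w. F w * G w)"

lemma complexification_exists: "real_polynomial_function f \<Longrightarrow> \<exists>F. complexification f F"
  by (induction rule: real_polynomial_function.induct) (blast intro: complexification.intros)+

lemma complexification_real: "complexification f F \<Longrightarrow> F (x, 0) = of_real (f x)"
  by (induction rule: complexification.induct)
    (auto simp: complex_eq_iff linear_0 bounded_linear.linear)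

lemma complexification_continuous: "complexification f F \<Longrightarrow> continuous_on UNIV F"
proof (induction rule: complexification.induct)
  case (linear f)
  have "continuous_on UNIV f"
    using linear by (simp add: linear_continuous_on)
  then show ?case
    unfolding Complex_eq
    by (intro continuous_intros; (rule continuous_on_compose2[of UNIV f])?) (auto intro: continuous_intros)
qed (auto intro: continuous_intros)

lemma complexification_line:
  "complexification f F \<Longrightarrow> \<exists>q. \<forall>z. F (w + z *\<^sub>C v) = poly q z"
proof (induction rule: complexification.induct)
  case (linear f)
  interpret bounded_linear f by fact
  have "\<forall>z. Complex (f (fst (w + z *\<^sub>C v))) (f (snd (w + z *\<^sub>C v))) =
    poly [:Complex (f (fst w)) (f (snd w)), Complex (f (fst v)) (f (snd v)):] z"
    by (simp add: cscale_def add diff scaleR complex_eq_iff algebra_simps)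
  then show ?case ..
next
  case (const c)
  have "\<forall>z. of_real c = poly [:of_real c:] z"
    by simp
  then show ?case ..
next
  case (add f F g G)
  then obtain q r where "\<forall>z. F (w + z *\<^sub>C v) = poly q z" "\<forall>z. G (w + z *\<^sub>C v) = poly r z"
    by blast
  then have "\<forall>z. F (w + z *\<^sub>C v) + G (w + z *\<^sub>C v) = poly (q + r) z"
    by simp
  then show ?case ..
next
  case (mult f F g G)
  then obtain q r where "\<forall>z. F (w + z *\<^sub>C v) = poly q z" "\<forall>z. G (w + z *\<^sub>C v) = poly r z"
    by blast
  then have "\<forall>z. F (w + z *\<^sub>C v) * G (w + z *\<^sub>C v) = poly (q * r) z"
    by simp
  then show ?case ..
qed

abbreviation cpoly :: "real poly \<Rightarrow> complex poly" where
  "cpoly \<equiv> map_poly of_real"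

lemma cpoly_hom: "cpoly (f + g) = cpoly f + cpoly g" "cpoly (f * g) = cpoly f * cpoly g"
  by (rule poly_eqI; simp add: coeff_map_poly coeff_mult)+

lemma poly_cpoly_real: "poly (cpoly f) (of_real t) = of_real (poly f t)"
  by (induction f) (simp_all add: map_poly_pCons)

text \<open>A first-order Taylor expansion in \<open>t\<close>. The polynomials \<open>B\<close> and
  \<open>N\<close> are real and serve all \<open>s\<close>, while \<open>E\<close> may vary with
  \<open>s\<close>; the quotient of \<open>N\<close> by \<open>B\<close> will be the trace as a
  function of \<open>s\<close>.\<close>

lemma complexification_first_order:
  "complexification f F \<Longrightarrow>
    \<exists>B N. \<forall>s. \<exists>E. \<forall>t. F ((x, 0) + s *\<^sub>C (c, 0) + t *\<^sub>C (w, 0)) =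
      poly (cpoly B) s + t * poly (cpoly N) s + t\<^sup>2 * poly E t"
proof (induction rule: complexification.induct)
  case (linear f)
  interpret bounded_linear f by fact
  show ?case
  proof (intro exI allI)
    fix s t :: complex
    show "Complex (f (fst ((x, 0) + s *\<^sub>C (c, 0) + t *\<^sub>C (w, 0))))
          (f (snd ((x, 0) + s *\<^sub>C (c, 0) + t *\<^sub>C (w, 0)))) =
        poly (cpoly [:f x, f c:]) s + t * poly (cpoly [:f w:]) s + t\<^sup>2 * poly 0 t"
      by (simp add: cscale_pair add diff scaleR complex_eq_iff map_poly_pCons)
  qed
next
  case (const c)
  show ?case
    by (intro exI[of _ "[:c:]"] exI[of _ "0::real poly"] allI exI[of _ "0::complex poly"])
      (simp add: map_poly_pCons)
next
  case (add f F g G)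
  then obtain B N B' N' where
    f: "\<forall>s. \<exists>E. \<forall>t. F ((x, 0) + s *\<^sub>C (c, 0) + t *\<^sub>C (w, 0)) =
      poly (cpoly B) s + t * poly (cpoly N) s + t\<^sup>2 * poly E t" and
    g: "\<forall>s. \<exists>E. \<forall>t. G ((x, 0) + s *\<^sub>C (c, 0) + t *\<^sub>C (w, 0)) =
      poly (cpoly B') s + t * poly (cpoly N') s + t\<^sup>2 * poly E t"
    by blast
  show ?case
  proof (rule exI[of _ "B + B'"], rule exI[of _ "N + N'"], rule allI)
    fix s
    obtain E E' where
      "\<forall>t. F ((x, 0) + s *\<^sub>C (c, 0) + t *\<^sub>C (w, 0)) =
        poly (cpoly B) s + t * poly (cpoly N) s + t\<^sup>2 * poly E t"
      "\<forall>t. G ((x, 0) + s *\<^sub>C (c, 0) + t *\<^sub>C (w, 0)) =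
        poly (cpoly B') s + t * poly (cpoly N') s + t\<^sup>2 * poly E' t"
      using f g by blast
    then show "\<exists>E. \<forall>t. F ((x, 0) + s *\<^sub>C (c, 0) + t *\<^sub>C (w, 0)) + G ((x, 0) + s *\<^sub>C (c, 0) + t *\<^sub>C (w, 0)) =
      poly (cpoly (B + B')) s + t * poly (cpoly (N + N')) s + t\<^sup>2 * poly E t"
      by (intro exI[of _ "E + E'"]) (simp add: cpoly_hom algebra_simps)
  qed
next
  case (mult f F g G)
  then obtain B N B' N' where
    f: "\<forall>s. \<exists>E. \<forall>t. F ((x, 0) + s *\<^sub>C (c, 0) + t *\<^sub>C (w, 0)) =
      poly (cpoly B) s + t * poly (cpoly N) s + t\<^sup>2 * poly E t" and
    g: "\<forall>s. \<exists>E. \<forall>t. G ((x, 0) + s *\<^sub>C (c, 0) + t *\<^sub>C (w, 0)) =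
      poly (cpoly B') s + t * poly (cpoly N') s + t\<^sup>2 * poly E t"
    by blast
  show ?case
  proof (rule exI[of _ "B * B'"], rule exI[of _ "B * N' + N * B'"], rule allI)
    fix s
    obtain E E' where
      "\<forall>t. F ((x, 0) + s *\<^sub>C (c, 0) + t *\<^sub>C (w, 0)) =
        poly (cpoly B) s + t * poly (cpoly N) s + t\<^sup>2 * poly E t"
      "\<forall>t. G ((x, 0) + s *\<^sub>C (c, 0) + t *\<^sub>C (w, 0)) =
        poly (cpoly B') s + t * poly (cpoly N') s + t\<^sup>2 * poly E' t"
      using f g by blast
    then show "\<exists>E. \<forall>t. F ((x, 0) + s *\<^sub>C (c, 0) + t *\<^sub>C (w, 0)) * G ((x, 0) + s *\<^sub>C (c, 0) + t *\<^sub>C (w, 0)) =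
      poly (cpoly (B * B')) s + t * poly (cpoly (B * N' + N * B')) s + t\<^sup>2 * poly E t"
      \<comment> \<open>The terms of order at least two in the product of the expansions, divided by
        t^2.\<close>
      by (intro exI[of _ "[:poly (cpoly N) s * poly (cpoly N') s:] +
            smult (poly (cpoly B) s) E' + smult (poly (cpoly B') s) E +
            [:0, 1:] * (smult (poly (cpoly N) s) E' + smult (poly (cpoly N') s) E) + [:0, 0, 1:] * (E * E')"])
        (simp add: cpoly_hom power2_eq_square algebra_simps)
  qed
qed

section \<open>Hyperbolic directions and their eigenvalues\<close>

locale complexified_polynomial =
  fixes p :: "'a::euclidean_space \<Rightarrow> real" and F :: "'a \<times> 'a \<Rightarrow> complex" and m :: nat
  assumes complexification: "complexification p F"
    and homogeneous: "p (t *\<^sub>R x) = t ^ m * p x"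
begin

lemma F_real: "F (x, 0) = of_real (p x)"
  using complexification by (rule complexification_real)

lemma F_line: obtains q where "\<And>z. F (w + z *\<^sub>C v) = poly q z"
  using complexification_line[OF complexification] by metis

text \<open>Two continuations from the real line: first in the scalar, on real vectors, then in
  \<open>t\<close> along x + ty up to t = i.\<close>

lemma F_cscale: "F (z *\<^sub>C w) = z ^ m * F w"
proof -
  have real: "F (z *\<^sub>C (x, 0)) = z ^ m * F (x, 0)" for x
  proof -
    obtain q where q: "\<And>z. F (0 + z *\<^sub>C (x, 0)) = poly q z"
      using F_line by blast
    have "q = monom (of_real (p x)) m"
    proof (rule poly_eq_on_reals)
      fix t :: real
      have "poly q (of_real t) = F (t *\<^sub>R x, 0)"
        by (simp flip: q add: cscale_pair)
      then show "poly q (of_real t) = poly (monom (of_real (p x)) m) (of_real t)"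
        by (simp add: F_real homogeneous poly_monom)
    qed
    then show ?thesis
      using q[of z] by (simp add: poly_monom F_real)
  qed
  obtain x y where w: "w = (x, y)"
    by fastforce
  obtain q where q: "\<And>t. F (z *\<^sub>C (x, 0) + t *\<^sub>C z *\<^sub>C (y, 0)) = poly q t"
    using F_line by blast
  obtain r where r: "\<And>t. F ((x, 0) + t *\<^sub>C (y, 0)) = poly r t"
    using F_line by blast
  have "q = smult (z ^ m) r"
  proof (rule poly_eq_on_reals)
    fix t :: real
    have "poly q (of_real t) = F (z *\<^sub>C (x + t *\<^sub>R y, 0))"
      by (simp flip: q add: cscale_pair algebra_simps)
    also have "\<dots> = z ^ m * F ((x, 0) + of_real t *\<^sub>C (y, 0))"
      unfolding real by (simp add: cscale_pair)
    finally show "poly q (of_real t) = poly (smult (z ^ m) r) (of_real t)"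
      by (simp add: r)
  qed
  then have "F (z *\<^sub>C (x, 0) + \<i> *\<^sub>C z *\<^sub>C (y, 0)) = z ^ m * F ((x, 0) + \<i> *\<^sub>C (y, 0))"
    by (simp add: q r)
  moreover have "z *\<^sub>C (x, 0) + \<i> *\<^sub>C z *\<^sub>C (y, 0) = z *\<^sub>C w" "(x, 0) + \<i> *\<^sub>C (y, 0) = w"
    by (simp_all add: w cscale_pair)
  ultimately show ?thesis
    by simp
qed

lemma continuous_on_F [continuous_intros]:
  "continuous_on S f \<Longrightarrow> continuous_on S (\<lambda>t. F (f t))"
  by (rule continuous_on_compose2[OF complexification_continuous[OF complexification]]) auto

text \<open>Hyperbolicity with respect to \<open>v\<close>: the extension of \<open>p\<close> has no zero with imaginary
  part \<open>v\<close>.\<close>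

definition hyp_direction :: "'a \<Rightarrow> bool" where
  "hyp_direction v \<longleftrightarrow> p v > 0 \<and> (\<forall>x. F (x, v) \<noteq> 0)"

lemma F_nonzero:
  assumes v: "hyp_direction v" and "t \<noteq> 0"
  shows "F (x, t *\<^sub>R v) \<noteq> 0"
proof -
  have "(x, t *\<^sub>R v) = of_real t *\<^sub>C ((1 / t) *\<^sub>R x, v)"
    using assms(2) by (simp add: cscale_pair)
  then show ?thesis
    using v assms(2) by (simp add: F_cscale hyp_direction_def)
qed

lemma hyp_direction_scaleR: "hyp_direction v \<Longrightarrow> t > 0 \<Longrightarrow> hyp_direction (t *\<^sub>R v)"
  using F_nonzero[of v t] unfolding hyp_direction_def by (simp add: homogeneous)

lemma F_line_degree:
  assumes "p v \<noteq> 0"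
  obtains q where "\<And>z. F (w + z *\<^sub>C (v, 0)) = poly q z" "degree q = m" "lead_coeff q = of_real (p v)"
proof -
  obtain q where q: "\<And>z. F (w + z *\<^sub>C (v, 0)) = poly q z"
    using F_line by blast
  obtain g where g: "\<And>z. F ((v, 0) + z *\<^sub>C w) = poly g z"
    using F_line by blast
  have g0: "poly g 0 = of_real (p v)"
    by (simp flip: g add: F_real)
  have qg: "poly q z = z ^ m * poly g (inverse z)" if "z \<noteq> 0" for z
  proof -
    have "w + z *\<^sub>C (v, 0) = z *\<^sub>C ((v, 0) + inverse z *\<^sub>C w)"
      using that by (simp add: cscale_add_right cscale_cscale)
    then show ?thesis
      by (simp flip: q g add: F_cscale)
  qed
  show thesis
    using that[OF q] poly_reversal_degree[OF qg] g0 assms by simp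
qed

text \<open>A nonreal root on the line through \<open>x\<close> would be a zero of \<open>F\<close>
  whose imaginary part is a nonzero multiple of \<open>v\<close>; so all roots are real, and the
  eigenvalues are their negatives.\<close>

lemma hyp_eigenvalues_exist:
  assumes v: "hyp_direction v"
  shows "\<exists>L. size L = m \<and> (\<forall>s. F ((x, 0) + s *\<^sub>C (v, 0)) = of_real (p v) * (\<Prod>l\<in>#L. s + of_real l))"
proof -
  have "p v \<noteq> 0"
    using v by (auto simp: hyp_direction_def)
  then obtain q where q: "\<And>z. F ((x, 0) + z *\<^sub>C (v, 0)) = poly q z" "degree q = m"
    "lead_coeff q = of_real (p v)"
    using F_line_degree[of v "(x, 0)"] by metis
  have "q \<noteq> 0"
    using q(3) \<open>p v \<noteq> 0\<close> by auto
  have real: "Im z = 0" if "z \<in># proots q" for z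
  proof (rule ccontr)
    assume "Im z \<noteq> 0"
    then have "poly q z \<noteq> 0"
      using F_nonzero[OF v, of "Im z" "x + Re z *\<^sub>R v"] by (simp flip: q(1) add: cscale_pair)
    then show False
      using that \<open>q \<noteq> 0\<close> by simp
  qed
  have "F ((x, 0) + s *\<^sub>C (v, 0)) =
      of_real (p v) * (\<Prod>l\<in>#image_mset (\<lambda>z. - Re z) (proots q). s + of_real l)" for s
  proof -
    have "poly q s = lead_coeff q * (\<Prod>z\<in>#proots q. s - z)"
      by (subst complex_poly_decompose_multiset[of q, symmetric])
        (simp add: poly_prod_mset image_mset.compositionality comp_def)
    also have "image_mset (\<lambda>z. s - z) (proots q) =
        image_mset (\<lambda>l. s + of_real l) (image_mset (\<lambda>z. - Re z) (proots q))"
      unfolding image_mset.compositionality comp_def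
      by (rule image_mset_cong) (use real in \<open>auto simp: complex_eq_iff\<close>)
    finally show ?thesis
      by (simp only: q(1,3))
  qed
  then show ?thesis
    using q(2) by (intro exI[of _ "image_mset (\<lambda>z. - Re z) (proots q)"]) (simp add: size_proots_complex)
qed

lemma of_real_prod_mset: "of_real (\<Prod>l\<in>#L. f l) = (\<Prod>l\<in>#L. of_real (f l) :: complex)"
  by (induction L) auto

lemma
  assumes v: "hyp_direction v"
  shows size_hyp_eigenvalues: "size (hyp_eigenvalues p v x) = m"
    and F_hyp_eigenvalues:
      "F ((x, 0) + s *\<^sub>C (v, 0)) = of_real (p v) * (\<Prod>l\<in>#hyp_eigenvalues p v x. s + of_real l)"
    and p_hyp_eigenvalues:
      "p (t *\<^sub>R v + x) = p v * (\<Prod>l\<in>#hyp_eigenvalues p v x. t + l)"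
proof -
  obtain L where L: "size L = m"
    "\<And>s. F ((x, 0) + s *\<^sub>C (v, 0)) = of_real (p v) * (\<Prod>l\<in>#L. s + of_real l)"
    using hyp_eigenvalues_exist[OF v] by blast
  have pL: "p (t *\<^sub>R v + x) = p v * (\<Prod>l\<in>#L. t + l)" for t
  proof -
    have "complex_of_real (p (t *\<^sub>R v + x)) = of_real (p v * (\<Prod>l\<in>#L. t + l))"
      using L(2)[of "of_real t"] by (simp add: cscale_pair F_real of_real_prod_mset add.commute)
    then show ?thesis
      by (simp only: of_real_eq_iff)
  qed
  have eq: "hyp_eigenvalues p v x = L"
    by (rule hyp_eigenvalues_unique) (use v pL in \<open>auto simp: hyp_direction_def\<close>)
  show "size (hyp_eigenvalues p v x) = m"
    "F ((x, 0) + s *\<^sub>C (v, 0)) = of_real (p v) * (\<Prod>l\<in>#hyp_eigenvalues p v x. s + of_real l)"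
    "p (t *\<^sub>R v + x) = p v * (\<Prod>l\<in>#hyp_eigenvalues p v x. t + l)"
    unfolding eq by (fact L pL)+
qed

lemma p_hyp_eigenvalues':
  assumes v: "hyp_direction v"
  shows "p (v + t *\<^sub>R x) = p v * (\<Prod>l\<in>#hyp_eigenvalues p v x. 1 + t * l)"
proof (cases "t = 0")
  case False
  let ?L = "hyp_eigenvalues p v x"
  have "p (v + t *\<^sub>R x) = t ^ m * p ((1 / t) *\<^sub>R v + x)"
    using False by (simp flip: homogeneous add: scaleR_add_right)
  also have "\<dots> = p v * (t ^ size ?L * (\<Prod>l\<in>#?L. 1 / t + l))"
    by (simp add: p_hyp_eigenvalues[OF v] size_hyp_eigenvalues[OF v])
  also have "t ^ size L * (\<Prod>l\<in>#L. 1 / t + l) = (\<Prod>l\<in>#L. 1 + t * l)" for L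
    using False by (induction L) (auto simp: field_simps)
  finally show ?thesis .
qed simp

section \<open>Garding's theorem\<close>

text \<open>Garding's theorem. Write \<open>a = a' + \<delta> b\<close> with \<open>a'\<close> still in the cone. The roots \<open>z\<close> of
  \<open>F (\<theta> x + z a' + i \<delta> b)\<close> lie in the lower half plane for \<open>\<theta> = 0\<close> and never meet the real axis, so
  they stay there up to \<open>\<theta> = 1\<close>, where \<open>F (x, a) = 0\<close> would give the root \<open>i\<close>.\<close>

lemma hyp_direction_garding_cone:
  assumes b: "hyp_direction b" and a: "a \<in> garding_cone p b"
  shows "hyp_direction a"
proof -
  define L where "L = hyp_eigenvalues p b a"
  have L: "l > 0" if "l \<in># L" for l
    using a that by (simp add: L_def garding_cone_def)
  have "\<exists>\<delta>>0. \<forall>l\<in>#L. \<delta> < l"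
  proof (cases "L = {#}")
    case False
    define \<mu> where "\<mu> = Min (set_mset L)"
    have "\<mu> > 0" "\<And>l. l \<in># L \<Longrightarrow> \<mu> \<le> l"
      using False L by (auto simp: \<mu>_def)
    then have "\<mu> / 2 > 0" "\<And>l. l \<in># L \<Longrightarrow> \<mu> / 2 < l"
      by force+
    then show ?thesis
      by blast
  qed (auto intro: exI[of _ 1])
  then obtain \<delta> where \<delta>: "\<delta> > 0" "\<And>l. l \<in># L \<Longrightarrow> \<delta> < l"
    by blast
  define a' where "a' = a - \<delta> *\<^sub>R b"
  have pb: "p b > 0"
    using b by (simp add: hyp_direction_def)
  have FL: "F ((a', 0) + s *\<^sub>C (b, 0)) = of_real (p b) * (\<Prod>l\<in>#L. s + of_real (l - \<delta>))" for s
  proof -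
    have "(a', 0) + s *\<^sub>C (b, 0) = (a, 0) + (s - of_real \<delta>) *\<^sub>C (b, 0)"
      by (simp add: a'_def cscale_pair algebra_simps)
    then show ?thesis
      using F_hyp_eigenvalues[OF b, of a "s - of_real \<delta>"] by (simp add: L_def algebra_simps)
  qed
  have pos: "(\<Prod>l\<in>#L. f l) > 0" if "\<And>l. l \<in># L \<Longrightarrow> f l > 0" for f :: "real \<Rightarrow> real"
    using that by (induction L) auto
  have "complex_of_real (p a') = of_real (p b * (\<Prod>l\<in>#L. l - \<delta>))"
    using FL[of 0] by (simp add: F_real of_real_prod_mset)
  then have "p a' > 0"
    unfolding of_real_eq_iff using pb pos[of "\<lambda>l. l - \<delta>"] \<delta>(2) by simp
  have "p a > 0"
    using p_hyp_eigenvalues[OF b, of 0 a] pb pos[of "\<lambda>l. l"] L by (simp add: L_def)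
  moreover have "F (x, a) \<noteq> 0" for x
  proof
    assume Fx: "F (x, a) = 0"
    define H where "H \<theta> z = F ((\<theta> *\<^sub>R x, \<delta> *\<^sub>R b) + z *\<^sub>C (a', 0))" for \<theta> z
    have H_real: "Im z \<noteq> 0" if "H \<theta> z = 0" for \<theta> z
      using F_nonzero[OF b, of \<delta> "\<theta> *\<^sub>R x + Re z *\<^sub>R a'"] \<delta>(1) that
      by (auto simp: H_def cscale_pair)
    have H_0: "Im z < 0" if "H 0 z = 0" for z
    proof (cases "z = 0")
      case False
      \<comment> \<open>Factoring out \<open>z\<close> gives an eigenvalue equation whose solution z
        = -i\<delta> / (l - \<delta>) lies on the negative imaginary axis.\<close>
      have "(0, \<delta> *\<^sub>R b) + z *\<^sub>C (a', 0) = z *\<^sub>C ((a', 0) + (\<i> * of_real \<delta> / z) *\<^sub>C (b, 0))"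
        using False by (simp add: cscale_add_right cscale_cscale) (simp add: cscale_pair)
      then have "F ((a', 0) + (\<i> * of_real \<delta> / z) *\<^sub>C (b, 0)) = 0"
        using that False by (simp add: H_def F_cscale)
      then obtain l where l: "l \<in># L" "\<i> * of_real \<delta> / z + of_real (l - \<delta>) = 0"
        using pb unfolding FL by auto
      then have "\<i> * of_real \<delta> = - of_real (l - \<delta>) * z"
        using False by (simp add: field_simps add_eq_0_iff2)
      then have "\<delta> = - (l - \<delta>) * Im z"
        by (simp add: complex_eq_iff)
      then have "(l - \<delta>) * Im z = - \<delta>"
        by (metis minus_minus minus_mult_left)
      then have "(l - \<delta>) * Im z < 0"
        using \<delta>(1) by linarith
      then show ?thesis
        using \<delta>(2)[OF l(1)] by (simp add: mult_less_0_iff)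
    qed (use H_real that in force)
    \<comment> \<open>The parameters with a root in the closed upper half plane form a clopen subset
      of the interval.\<close>
    define T where "T = {\<theta> \<in> {0..1}. \<exists>z. Im z \<ge> 0 \<and> H \<theta> z = 0}"
    then have T01: "T \<subseteq> {0..1}"
      by auto
    have "closed T"
    proof -
      \<comment> \<open>Roots could escape to infinity, so they are written z = v/u with (u, v) on
        the unit sphere, where compactness applies. The point u = 0 is excluded because
        \<open>p a'\<close> is nonzero.\<close>
      define K where "K = {w :: real \<times> complex \<times> complex. Im (snd (snd w) * cnj (fst (snd w))) \<ge> 0 \<and>
        F (fst (snd w) *\<^sub>C (fst w *\<^sub>R x, \<delta> *\<^sub>R b) + snd (snd w) *\<^sub>C (a', 0)) = 0}"
      have "closed K"
        unfolding K_def
        by (intro closed_Collect_conj closed_Collect_le closed_Collect_eq continuous_intros)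
      then have "compact (({0..1} \<times> sphere 0 1) \<inter> K)"
        by (intro compact_Int_closed compact_Times compact_Icc compact_sphere)
      then have "compact (fst ` (({0..1} \<times> sphere 0 1) \<inter> K))"
        by (intro compact_continuous_image continuous_intros)
      moreover have "fst ` (({0..1} \<times> sphere 0 1) \<inter> K) = T"
      proof (intro set_eqI iffI)
        fix \<theta> assume "\<theta> \<in> fst ` (({0..1} \<times> sphere 0 1) \<inter> K)"
        then obtain u v where uv: "\<theta> \<in> {0..1}" "norm (u, v) = 1" "Im (v * cnj u) \<ge> 0"
          "F (u *\<^sub>C (\<theta> *\<^sub>R x, \<delta> *\<^sub>R b) + v *\<^sub>C (a', 0)) = 0"
          by (auto simp: K_def)
        have "u \<noteq> 0"
        proof
          assume "u = 0"
          then have "v ^ m * of_real (p a') = 0"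
            using uv(4) by (simp add: F_cscale F_real)
          then show False
            using uv(2) \<open>u = 0\<close> \<open>p a' > 0\<close> by (auto simp: norm_Pair)
        qed
        have "u *\<^sub>C (\<theta> *\<^sub>R x, \<delta> *\<^sub>R b) + v *\<^sub>C (a', 0) =
            u *\<^sub>C ((\<theta> *\<^sub>R x, \<delta> *\<^sub>R b) + (v / u) *\<^sub>C (a', 0))"
          using \<open>u \<noteq> 0\<close> by (simp add: cscale_add_right cscale_cscale)
        then have "H \<theta> (v / u) = 0"
          using uv(4) \<open>u \<noteq> 0\<close> by (simp add: F_cscale H_def)
        moreover have "Im (v / u) \<ge> 0"
          using uv(3) by (simp add: complex_div_cnj[of v u])
        ultimately show "\<theta> \<in> T"
          using uv(1) by (auto simp: T_def)
      next
        fix \<theta> assume "\<theta> \<in> T"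
        then obtain z where z: "\<theta> \<in> {0..1}" "Im z \<ge> 0" "H \<theta> z = 0"
          by (auto simp: T_def)
        define n where "n = 1 / norm (1::complex, z)"
        have "norm (1::complex, z) > 0"
          by (simp add: norm_Pair add_pos_nonneg)
        then have "n > 0" "\<bar>n\<bar> * norm (1::complex, z) = 1"
          by (simp_all add: n_def)
        have "of_real n *\<^sub>C (\<theta> *\<^sub>R x, \<delta> *\<^sub>R b) + (of_real n * z) *\<^sub>C (a', 0) =
            of_real n *\<^sub>C ((\<theta> *\<^sub>R x, \<delta> *\<^sub>R b) + z *\<^sub>C (a', 0))"
          by (simp add: cscale_add_right cscale_cscale)
        then have "(\<theta>, of_real n, of_real n * z) \<in> K"
          using z \<open>n > 0\<close> by (simp add: K_def F_cscale H_def)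
        moreover have "(of_real n, of_real n * z) = n *\<^sub>R (1::complex, z)"
          by (simp add: scaleR_conv_of_real)
        then have "norm (of_real n :: complex, of_real n * z) = 1"
          using \<open>\<bar>n\<bar> * norm (1::complex, z) = 1\<close> by (simp only: norm_scaleR)
        ultimately show "\<theta> \<in> fst ` (({0..1} \<times> sphere 0 1) \<inter> K)"
          using z(1) by (intro image_eqI[of _ _ "(\<theta>, of_real n, of_real n * z)"]) auto
      qed
      ultimately show ?thesis
        by (simp add: compact_imp_closed)
    qed
    moreover have "openin (top_of_set {0..1}) T"
      unfolding openin_euclidean_subtopology_iff
    proof (intro conjI ballI)
      fix \<theta>0 assume "\<theta>0 \<in> T"
      then obtain z0 where z0: "Im z0 \<ge> 0" "H \<theta>0 z0 = 0"
        by (auto simp: T_def)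
      then have "Im z0 > 0"
        using H_real by force
      \<comment> \<open>The root \<open>z0\<close> lies strictly above the real axis, and the disc
        of radius \<open>Im z0\<close> around it stays in the upper half plane. Nearby parameters
        have a root in that disc.\<close>
      have "continuous_on UNIV (\<lambda>\<theta>. H \<theta> z0)"
        unfolding H_def by (intro continuous_intros)
      then have "isCont (\<lambda>\<theta>. H \<theta> z0) \<theta>0"
        by (simp add: continuous_on_eq_continuous_at)
      moreover have "p a' * Im z0 ^ m > 0"
        using \<open>Im z0 > 0\<close> \<open>p a' > 0\<close> by simp
      ultimately obtain d where d: "d > 0"
        "\<And>\<theta>. dist \<theta> \<theta>0 < d \<Longrightarrow> norm (H \<theta> z0) < p a' * Im z0 ^ m"
        unfolding continuous_at_eps_delta using z0(2) by (metis dist_0_norm dist_commute)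
      have "\<theta> \<in> T" if \<theta>: "\<theta> \<in> {0..1}" "dist \<theta> \<theta>0 < d" for \<theta>
      proof -
        obtain q where q: "\<And>z. H \<theta> z = poly q z" "degree q = m" "lead_coeff q = of_real (p a')"
          using F_line_degree[of a' "(\<theta> *\<^sub>R x, \<delta> *\<^sub>R b)"] \<open>p a' > 0\<close> unfolding H_def by auto
        have "norm (poly q z0) < norm (complex_of_real (p a')) * Im z0 ^ m"
          using d(2)[OF \<theta>(2)] \<open>p a' > 0\<close> by (simp flip: q(1))
        then have "norm (poly q z0) < norm (lead_coeff q) * Im z0 ^ degree q"
          by (subst q(3), subst q(2))
        then have "\<exists>z. poly q z = 0 \<and> norm (z0 - z) < Im z0"
          by (rule poly_root_near[OF \<open>Im z0 > 0\<close>])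
        then obtain z where z: "H \<theta> z = 0" "norm (z0 - z) < Im z0"
          by (auto simp: q)
        have "\<bar>Im (z0 - z)\<bar> < Im z0"
          using abs_Im_le_cmod z(2) by (rule le_less_trans)
        then have "Im z \<ge> 0"
          by simp
        then show ?thesis
          using z(1) \<theta>(1) by (auto simp: T_def)
      qed
      then show "\<exists>d>0. \<forall>\<theta>\<in>{0..1}. dist \<theta> \<theta>0 < d \<longrightarrow> \<theta> \<in> T"
        using d(1) by blast
    qed (auto simp: T_def)
    moreover have "connected {0..1::real}"
      by simp
    ultimately have "T = {} \<or> T = {0..1}"
      unfolding connected_clopen using closed_subset[of T "{0..1}"] T01 by blast
    moreover have "0 \<notin> T"
      using H_0 by (force simp: T_def)
    moreover have "1 \<in> T"
      using Fx by (auto simp: T_def H_def cscale_pair a'_def intro!: exI[of _ \<i>])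
    ultimately show False
      by auto
  qed
  ultimately show ?thesis
    by (simp add: hyp_direction_def)
qed

section \<open>Monotonicity of the trace in the direction\<close>

lemma linear_coeff_hyp_trace:
  fixes b n :: complex
  assumes v: "hyp_direction v"
    and E: "\<And>t::real. of_real (p (v + t *\<^sub>R w)) = b + of_real t * n + (of_real t)\<^sup>2 * poly E (of_real t)"
  shows "b = of_real (p v)" "n = of_real (p v * hyp_trace p v w)"
proof -
  let ?P = "\<lambda>L. \<Prod>l\<in>#L. [:1, complex_of_real l:]"
  have coeffs: "coeff (?P L) 0 = 1 \<and> coeff (?P L) 1 = of_real (\<Sum>\<^sub># L)" for L
    by (induction L) auto
  \<comment> \<open>Since p (v + t w) is \<open>p v\<close> times the product of the factors 1 + tl,
    the trace is the logarithmic derivative of \<open>p\<close> at \<open>v\<close> along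
    \<open>w\<close>.\<close>
  have "[:b, n:] + monom 1 2 * E = smult (of_real (p v)) (?P (hyp_eigenvalues p v w))"
  proof (rule poly_eq_on_reals)
    fix t :: real
    have "poly (?P L) (of_real t) = of_real (\<Prod>l\<in>#L. 1 + t * l)" for L
      by (induction L) (auto simp: algebra_simps)
    then show "poly ([:b, n:] + monom 1 2 * E) (of_real t) =
        poly (smult (of_real (p v)) (?P (hyp_eigenvalues p v w))) (of_real t)"
      using E[of t] by (simp add: p_hyp_eigenvalues'[OF v] poly_monom algebra_simps)
  qed
  then have eq: "coeff ([:b, n:] + monom 1 2 * E) i =
      coeff (smult (of_real (p v)) (?P (hyp_eigenvalues p v w))) i" for i
    by simp
  show "b = of_real (p v)"
    using eq[of 0] coeffs by (simp add: coeff_monom_mult)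
  show "n = of_real (p v * hyp_trace p v w)"
    using eq[of 1] coeffs by (simp add: coeff_monom_mult hyp_trace_def)
qed

text \<open>The function \<open>R s = hyp_trace p (x + s c) w\<close> is rational in \<open>s\<close>, real on the real line, and
  maps the upper half plane to the lower one; hence its derivative at real points is nonpositive.\<close>

lemma hyp_trace_antimono:
  assumes seg: "\<And>s. 0 \<le> s \<Longrightarrow> s \<le> 1 \<Longrightarrow> hyp_direction (x + s *\<^sub>R c)"
    and cone: "\<And>s t. s > 0 \<Longrightarrow> t \<ge> 0 \<Longrightarrow> hyp_direction (s *\<^sub>R c + t *\<^sub>R w)"
  shows "hyp_trace p (x + c) w \<le> hyp_trace p x w"
proof -
  obtain B N where BN: "\<And>s. \<exists>E. \<forall>t. F ((x, 0) + s *\<^sub>C (c, 0) + t *\<^sub>C (w, 0)) =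
      poly (cpoly B) s + t * poly (cpoly N) s + t\<^sup>2 * poly E t"
    using complexification_first_order[OF complexification, of x c w] by blast
  define R where "R s = poly (cpoly N) s / poly (cpoly B) s" for s
  have upper: "Im (R s) \<le> 0" if "Im s > 0" for s
  proof -
    obtain E where E: "\<And>t. F ((x, 0) + s *\<^sub>C (c, 0) + t *\<^sub>C (w, 0)) =
        poly (cpoly B) s + t * poly (cpoly N) s + t\<^sup>2 * poly E t"
      using BN by blast
    define q where "q = [:poly (cpoly B) s, poly (cpoly N) s:] + monom 1 2 * E"
    have q: "poly q t = F ((x, 0) + s *\<^sub>C (c, 0) + t *\<^sub>C (w, 0))" for t
      unfolding E q_def by (simp add: poly_monom algebra_simps)
    \<comment> \<open>For \<open>t\<close> in the closed upper half plane the imaginary part of the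
      argument is a hyperbolic direction, so all roots in \<open>t\<close> lie below the real
      axis.\<close>
    have nz: "poly q t \<noteq> 0" if "Im t \<ge> 0" for t
    proof -
      have "(x, 0) + s *\<^sub>C (c, 0) + t *\<^sub>C (w, 0) =
          (x + Re s *\<^sub>R c + Re t *\<^sub>R w, Im s *\<^sub>R c + Im t *\<^sub>R w)"
        by (simp add: cscale_pair)
      then show ?thesis
        using cone[OF \<open>Im s > 0\<close> that] by (simp add: q hyp_direction_def)
    qed
    have "Im (poly (pderiv q) 0 / poly q 0) \<le> 0"
    proof (rule Im_log_derivative_nonpos)
      show "Im z \<le> 0" if "poly q z = 0" for z
        using nz[of z] that by fastforce
    qed (use nz[of 0] in simp)
    moreover have "poly q 0 = poly (cpoly B) s" "poly (pderiv q) 0 = poly (cpoly N) s"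
      by (simp_all add: q_def pderiv_add pderiv_mult pderiv_pCons pderiv_monom poly_monom)
    ultimately show ?thesis
      by (simp add: R_def)
  qed
  have trace: "poly B s > 0 \<and> poly N s / poly B s = hyp_trace p (x + s *\<^sub>R c) w"
    if "0 \<le> s" "s \<le> 1" for s
  proof -
    have dir: "hyp_direction (x + s *\<^sub>R c)"
      using seg that by blast
    obtain E where E: "\<And>t. F ((x, 0) + of_real s *\<^sub>C (c, 0) + t *\<^sub>C (w, 0)) =
        poly (cpoly B) (of_real s) + t * poly (cpoly N) (of_real s) + t\<^sup>2 * poly E t"
      using BN by blast
    have "of_real (p (x + s *\<^sub>R c + t *\<^sub>R w)) = poly (cpoly B) (of_real s) +
        of_real t * poly (cpoly N) (of_real s) + (of_real t)\<^sup>2 * poly E (of_real t)" for t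
      using E[of "of_real t"] by (simp add: cscale_pair F_real)
    from linear_coeff_hyp_trace[OF dir this] show ?thesis
      using dir by (simp add: poly_cpoly_real hyp_direction_def del: of_real_mult)
  qed
  have pderiv_cpoly: "pderiv (cpoly f) = cpoly (pderiv f)" for f
    by (rule poly_eqI) (simp add: coeff_pderiv coeff_map_poly)
  have deriv: "\<exists>D\<le>0. ((\<lambda>s. poly N s / poly B s) has_real_derivative D) (at s)"
    if s: "0 \<le> s" "s \<le> 1" for s
  proof -
    have Bs: "poly B s \<noteq> 0"
      using trace[OF s] by simp
    define D where "D = (poly (pderiv N) s * poly B s - poly N s * poly (pderiv B) s) / (poly B s * poly B s)"
    have "((\<lambda>s. poly N s / poly B s) has_real_derivative D) (at s)"
      unfolding D_def by (rule DERIV_divide) (use Bs in \<open>auto intro: poly_DERIV\<close>)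
    moreover have "D \<le> 0"
    proof -
      have "(R has_field_derivative
          (poly (pderiv (cpoly N)) (of_real s) * poly (cpoly B) (of_real s) -
           poly (cpoly N) (of_real s) * poly (pderiv (cpoly B)) (of_real s)) /
          (poly (cpoly B) (of_real s) * poly (cpoly B) (of_real s))) (at (of_real s))"
        unfolding R_def by (rule DERIV_divide) (use Bs in \<open>auto intro: poly_DERIV simp: poly_cpoly_real\<close>)
      then have "(R has_field_derivative of_real D) (at (of_real s))"
        by (simp add: D_def pderiv_cpoly poly_cpoly_real)
      then have "((\<lambda>h. (R (of_real s + h) - R (of_real s)) / h) \<longlongrightarrow> of_real D) (at 0)"
        by (simp add: DERIV_def)
      \<comment> \<open>The derivative is computed along the vertical approach s + i\<epsilon>,
        where the real part of the difference quotient is the imaginary part of \<open>R\<close>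
        divided by \<epsilon>.\<close>
      moreover have "filterlim (\<lambda>\<epsilon>. \<i> * complex_of_real \<epsilon>) (at 0) (at_right 0)"
        unfolding filterlim_at
        by (auto intro!: tendsto_eq_intros simp: eventually_at_filter)
      ultimately have "((\<lambda>\<epsilon>. (R (of_real s + \<i> * of_real \<epsilon>) - R (of_real s)) / (\<i> * of_real \<epsilon>))
          \<longlongrightarrow> of_real D) (at_right 0)"
        by (rule filterlim_compose)
      then have lim: "((\<lambda>\<epsilon>. Re ((R (of_real s + \<i> * of_real \<epsilon>) - R (of_real s)) / (\<i> * of_real \<epsilon>)))
          \<longlongrightarrow> D) (at_right 0)"
        using tendsto_Re by fastforce
      have "Im (R (of_real s)) = 0"
        by (simp add: R_def poly_cpoly_real flip: of_real_divide)
      then have "Re ((R (of_real s + \<i> * of_real \<epsilon>) - R (of_real s)) / (\<i> * of_real \<epsilon>)) \<le> 0"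
        if "\<epsilon> > 0" for \<epsilon>
        using upper[of "of_real s + \<i> * of_real \<epsilon>"] that
        by (simp add: Re_divide power2_eq_square divide_nonpos_pos mult_nonpos_nonneg)
      then show "D \<le> 0"
        by (intro tendsto_upperbound[OF lim]) (auto simp: eventually_at_filter)
    qed
    ultimately show ?thesis
      by blast
  qed
  have "poly N 1 / poly B 1 \<le> poly N 0 / poly B 0"
    by (rule DERIV_nonpos_imp_nonincreasing) (use deriv in auto)
  then show ?thesis
    using trace[of 0] trace[of 1] by simp
qed

lemma hyp_trace_scaleR_direction:
  assumes v: "hyp_direction v" and t: "t > 0"
  shows "hyp_trace p (t *\<^sub>R v) w = hyp_trace p v w / t"
proof -
  let ?L = "hyp_eigenvalues p v w"
  have "hyp_eigenvalues p (t *\<^sub>R v) w = image_mset (\<lambda>l. l / t) ?L"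
  proof (rule hyp_eigenvalues_unique)
    show "p (t *\<^sub>R v) \<noteq> 0"
      using hyp_direction_scaleR[OF v t] by (auto simp: hyp_direction_def)
    fix s
    have "p (s *\<^sub>R t *\<^sub>R v + w) = p v * (\<Prod>l\<in>#?L. s * t + l)"
      using p_hyp_eigenvalues[OF v, of "s * t" w] by simp
    also have "(\<Prod>l\<in>#L. s * t + l) = t ^ size L * (\<Prod>l\<in>#image_mset (\<lambda>l. l / t) L. s + l)" for L
      using t by (induction L) (auto simp: field_simps)
    finally show "p (s *\<^sub>R t *\<^sub>R v + w) = p (t *\<^sub>R v) * (\<Prod>l\<in>#image_mset (\<lambda>l. l / t) ?L. s + l)"
      by (simp add: homogeneous size_hyp_eigenvalues[OF v])
  qed
  moreover have "(\<Sum>l\<in>#L. l / t) = \<Sum>\<^sub># L / t" for L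
    by (induction L) (auto simp: add_divide_distrib)
  ultimately show ?thesis
    by (simp add: hyp_trace_def)
qed

section \<open>Growth of the polynomial along a frame\<close>

lemma bernoulli_powr:
  fixes \<theta> \<mu> :: real
  assumes "\<theta> > 0" "0 \<le> \<mu>" "\<mu> \<le> 1"
  shows "\<theta> powr \<mu> \<le> 1 + (\<theta> - 1) * \<mu>"
proof -
  have "1 powr (1 - \<mu>) * \<theta> powr \<mu> \<le> (1 - \<mu>) * 1 + \<mu> * \<theta>"
    using assms by (intro Youngs_inequality_0) auto
  then show ?thesis
    by (simp add: algebra_simps)
qed

text \<open>The eigenvalues of \<open>w\<close> in direction \<open>y + w\<close> lie in the unit interval, so Bernoulli's
  inequality applies to each of the factors \<open>1 + (1 / \<theta> - 1) \<mu>\<close> of \<open>p (y + w / \<theta>) / p (y + w)\<close>.\<close>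

lemma p_scale_part_ge:
  fixes \<theta> k :: real
  assumes pos: "\<And>s t. s > 0 \<Longrightarrow> t > 0 \<Longrightarrow> hyp_direction (s *\<^sub>R y + t *\<^sub>R w)"
    and \<theta>: "\<theta> \<ge> 1" and trace: "hyp_trace p (y + w) w \<le> k"
  shows "p (\<theta> *\<^sub>R y + w) \<ge> p (y + w) * \<theta> powr (m - k)"
proof -
  let ?v = "y + w" and ?L = "hyp_eigenvalues p (y + w) w"
  have v: "hyp_direction ?v"
    using pos[of 1 1] by simp
  have pv: "p ?v > 0"
    using v by (simp add: hyp_direction_def)
  \<comment> \<open>For s > -1 the point y + (1 + s) w is a hyperbolic direction, where
    \<open>p\<close> is positive. An eigenvalue \<open>l\<close> outside the unit interval would
    give a zero at s = -1/l > -1.\<close>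
  have nz: "1 + s * l \<noteq> 0" if "l \<in># ?L" "s > -1" for s l
  proof
    assume "1 + s * l = 0"
    then have "(\<Prod>l\<in>#?L. 1 + s * l) = 0"
      using that(1) by (auto simp: prod_mset_zero_iff)
    then have "p (?v + s *\<^sub>R w) = 0"
      by (simp add: p_hyp_eigenvalues'[OF v])
    moreover have "?v + s *\<^sub>R w = 1 *\<^sub>R y + (1 + s) *\<^sub>R w"
      by (simp add: algebra_simps)
    ultimately show False
      using pos[of 1 "1 + s"] that(2) by (simp add: hyp_direction_def)
  qed
  have L01: "0 \<le> l \<and> l \<le> 1" if "l \<in># ?L" for l
  proof (rule ccontr)
    assume *: "\<not> ?thesis"
    then have "- 1 / l > - 1" "l \<noteq> 0"
      by (auto simp: field_simps)
    then show False
      using nz[OF that, of "- 1 / l"] by simp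
  qed
  have prod: "(\<Prod>l\<in>#L. 1 + (1 / \<theta> - 1) * l) \<ge> (1 / \<theta>) powr \<Sum>\<^sub># L"
    if "\<And>l. l \<in># L \<Longrightarrow> 0 \<le> l \<and> l \<le> 1" for L
    using that
  proof (induction L)
    case (add l L)
    then have "(1 / \<theta>) powr l * (1 / \<theta>) powr \<Sum>\<^sub># L \<le>
        (1 + (1 / \<theta> - 1) * l) * (\<Prod>l\<in>#L. 1 + (1 / \<theta> - 1) * l)"
      using \<theta> by (intro mult_mono bernoulli_powr order_trans[OF powr_ge_zero bernoulli_powr]) auto
    then show ?case
      by (simp add: powr_add)
  qed (use \<theta> in simp)
  have "p ?v * \<theta> powr (m - k) \<le> p ?v * \<theta> powr (m - \<Sum>\<^sub># ?L)"
    using \<theta> trace pv by (intro mult_left_mono powr_mono) (auto simp: hyp_trace_def)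
  also have "\<theta> powr (m - \<Sum>\<^sub># ?L) = \<theta> ^ m * (1 / \<theta>) powr \<Sum>\<^sub># ?L"
    using \<theta> by (simp add: powr_diff powr_realpow powr_divide)
  also have "p ?v * (\<theta> ^ m * (1 / \<theta>) powr \<Sum>\<^sub># ?L) \<le>
      p ?v * (\<theta> ^ m * (\<Prod>l\<in>#?L. 1 + (1 / \<theta> - 1) * l))"
    using prod[OF L01] \<theta> pv by (intro mult_left_mono) auto
  also have "\<dots> = \<theta> ^ m * p (?v + (1 / \<theta> - 1) *\<^sub>R w)"
    by (simp add: p_hyp_eigenvalues'[OF v])
  also have "\<dots> = p (\<theta> *\<^sub>R y + w)"
    using \<theta> by (simp flip: homogeneous add: algebra_simps)
  finally show ?thesis .
qed

text \<open>Induction on a set \<open>S\<close> outside which all coefficients are 1. Dividing the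
  coefficients on \<open>S\<close> by their minimum \<theta> brings at least one of them to 1, which
  shrinks \<open>S\<close>; \<open>p_scale_part_ge\<close> undoes the division.\<close>

lemma product_bound_ge_1:
  fixes C :: "'a set"
  assumes C: "finite C"
    and dir: "\<And>k. (\<And>c. c \<in> C \<Longrightarrow> k c > 0) \<Longrightarrow> hyp_direction (\<Sum>c\<in>C. k c *\<^sub>R c)"
    and trace: "\<And>S. S \<subseteq> C \<Longrightarrow> hyp_trace p (\<Sum>C) (\<Sum>S) = m / card C * card S"
    and "S \<subseteq> C" "\<And>c. c \<in> S \<Longrightarrow> l c \<ge> 1" "\<And>c. c \<in> C - S \<Longrightarrow> l c = 1"
  shows "p (\<Sum>c\<in>C. l c *\<^sub>R c) \<ge> p (\<Sum>C) * (\<Prod>c\<in>C. l c) powr (m / card C)"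
  using assms(4-)
proof (induction "card S" arbitrary: S l)
  case 0
  then have "S = {}"
    using finite_subset[OF _ C] by simp
  then have "\<And>c. c \<in> C \<Longrightarrow> l c = 1"
    using 0 by simp
  then show ?case
    by simp
next
  case (Suc n)
  have S: "finite S" "S \<noteq> {}"
    using Suc.hyps(2) card.infinite by fastforce+
  define \<theta> where "\<theta> = Min (l ` S)"
  have "\<theta> \<in> l ` S"
    unfolding \<theta>_def using S by (intro Min_in) auto
  then obtain c0 where c0: "c0 \<in> S" "\<theta> = l c0"
    by blast
  have "\<theta> \<ge> 1"
    using Suc.prems(2)[OF c0(1)] c0(2) by simp
  moreover have "\<theta> \<le> l c" if "c \<in> S" for c
    unfolding \<theta>_def using S(1) that by (intro Min_le) auto
  ultimately have \<theta>: "\<theta> \<ge> 1" "\<And>c. c \<in> S \<Longrightarrow> \<theta> \<le> l c"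
    by blast+
  define l' where "l' c = (if c \<in> S then l c / \<theta> else 1)" for c
  have l'1: "l' c \<ge> 1" for c
    using \<theta> by (auto simp: l'_def)
  have IH: "p (\<Sum>C) * (\<Prod>c\<in>C. l' c) powr (m / card C) \<le> p (\<Sum>c\<in>C. l' c *\<^sub>R c)"
  proof (rule Suc.hyps(1))
    show "n = card (S - {c0})" "S - {c0} \<subseteq> C"
      using Suc.hyps(2) Suc.prems(1) c0 S by auto
    show "l' c = 1" if "c \<in> C - (S - {c0})" for c
      using that c0 \<theta>(1) by (auto simp: l'_def)
  qed (rule l'1)
  define y where "y = (\<Sum>c\<in>S. l' c *\<^sub>R c)"
  define w where "w = \<Sum>(C - S)"
  have split: "(\<Sum>c\<in>C. f c) = (\<Sum>c\<in>S. f c) + (\<Sum>c\<in>C - S. f c)" for f :: "'a \<Rightarrow> 'a"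
    using sum.subset_diff[OF Suc.prems(1) C, of f] by (simp add: add.commute)
  have comb: "s *\<^sub>R y + t *\<^sub>R w = (\<Sum>c\<in>C. (if c \<in> S then s * l' c else t) *\<^sub>R c)" for s t
    unfolding split by (simp add: y_def w_def scaleR_sum_right)
  have yw: "y + w = (\<Sum>c\<in>C. l' c *\<^sub>R c)"
    using comb[of 1 1] by (simp add: l'_def cong: if_cong)
  have \<theta>yw: "\<theta> *\<^sub>R y + w = (\<Sum>c\<in>C. l c *\<^sub>R c)"
    using comb[of \<theta> 1] \<theta>(1) Suc.prems(3) by (auto simp: l'_def intro!: sum.cong)
  have e: "s *\<^sub>R \<Sum>C = (\<Sum>c\<in>C. s *\<^sub>R c)" for s
    by (rule scaleR_sum_right)
  have tw: "t *\<^sub>R w = (\<Sum>c\<in>C. (if c \<in> S then 0 else t) *\<^sub>R c)" for t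
    using comb[of 0 t] by (simp cong: if_cong)
  let ?k = "m / card C * card (C - S)"
  have "hyp_trace p (y + w) w \<le> ?k"
  \<comment> \<open>Some \<open>l' c\<close> may equal 1, so y + w minus the frame sum can lie on
    the boundary of the cone. Subtracting only \<open>z\<close> times the frame sum keeps all
    coefficients positive, at the price of a factor 1/z that disappears as \<open>z\<close> tends to
    1.\<close>
  proof (rule field_le_mult_one_interval)
    fix z :: real assume z: "0 < z" "z < 1"
    have less: "z < l' c" for c
      using z(2) l'1[of c] by simp
    let ?c = "y + w - z *\<^sub>R \<Sum>C"
    have c: "?c = (\<Sum>c\<in>C. (l' c - z) *\<^sub>R c)"
      by (simp add: yw e scaleR_diff_left sum_subtractf)
    have "hyp_trace p (z *\<^sub>R \<Sum>C + ?c) w \<le> hyp_trace p (z *\<^sub>R \<Sum>C) w"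
    proof (rule hyp_trace_antimono)
      fix s :: real assume s: "0 \<le> s" "s \<le> 1"
      have "z *\<^sub>R \<Sum>C + s *\<^sub>R ?c = (\<Sum>c\<in>C. (z + s * (l' c - z)) *\<^sub>R c)"
        unfolding c unfolding e by (simp add: scaleR_sum_right sum.distrib scaleR_add_left)
      also have "hyp_direction \<dots>"
      proof (rule dir)
        show "z + s * (l' c - z) > 0" for c
          using z(1) s(1) less[of c] by (intro add_pos_nonneg mult_nonneg_nonneg) auto
      qed
      finally show "hyp_direction (z *\<^sub>R \<Sum>C + s *\<^sub>R ?c)" .
    next
      fix s t :: real assume st: "0 < s" "0 \<le> t"
      have "s *\<^sub>R ?c + t *\<^sub>R w = (\<Sum>c\<in>C. (s * (l' c - z) + (if c \<in> S then 0 else t)) *\<^sub>R c)"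
        unfolding c tw by (simp only: scaleR_sum_right sum.distrib scaleR_add_left scaleR_scaleR)
      also have "hyp_direction \<dots>"
      proof (rule dir)
        show "s * (l' c - z) + (if c \<in> S then 0 else t) > 0" for c
          using st less[of c] by (intro add_pos_nonneg mult_pos_pos) auto
      qed
      finally show "hyp_direction (s *\<^sub>R ?c + t *\<^sub>R w)" .
    qed
    also have "\<dots> = ?k / z"
      using dir[of "\<lambda>_. 1"] trace[of "C - S"] z(1) by (simp add: hyp_trace_scaleR_direction w_def)
    finally have "hyp_trace p (y + w) w \<le> ?k / z"
      by simp
    then show "z * hyp_trace p (y + w) w \<le> ?k"
      using pos_le_divide_eq[OF z(1)] by (metis mult.commute)
  qed
  then have "p (y + w) * \<theta> powr (m - ?k) \<le> p (\<theta> *\<^sub>R y + w)"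
  proof (rule p_scale_part_ge[rotated 2])
    fix s t :: real assume "0 < s" "0 < t"
    then show "hyp_direction (s *\<^sub>R y + t *\<^sub>R w)"
      unfolding comb using l'1 by (intro dir) (auto intro: mult_pos_pos less_le_trans[OF zero_less_one])
  qed (fact \<theta>(1))
  moreover have "p (\<Sum>C) * (\<Prod>c\<in>C. l c) powr (m / card C) =
      p (\<Sum>C) * (\<Prod>c\<in>C. l' c) powr (m / card C) * \<theta> powr (m - ?k)"
  proof -
    have cardC: "card C = card S + card (C - S)" "card C > 0"
      using Suc.prems(1) C S card_mono[OF C, of S] by (auto simp: card_Diff_subset card_gt_0_iff)
    have "(\<Prod>c\<in>C. l c) = (\<Prod>c\<in>C. (if c \<in> S then \<theta> else 1) * l' c)"
      using \<theta>(1) Suc.prems(3) by (intro prod.cong) (auto simp: l'_def)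
    also have "\<dots> = \<theta> ^ card S * (\<Prod>c\<in>C. l' c)"
      using Suc.prems(1) C by (simp add: prod.distrib prod.If_cases Int_absorb1)
    finally have "(\<Prod>c\<in>C. l c) powr (m / card C) = (\<theta> ^ card S) powr (m / card C) * (\<Prod>c\<in>C. l' c) powr (m / card C)"
      using \<theta>(1) l'1 by (simp add: powr_mult prod_nonneg order_trans[OF zero_le_one])
    moreover have "(\<theta> ^ card S) powr (m / card C) = \<theta> powr (card S * (m / card C))"
      using \<theta>(1) by (simp add: powr_powr flip: powr_realpow)
    moreover have "card S * (m / card C) = m - ?k"
    proof -
      have "real (card S) = card C - real (card (C - S))"
        using cardC(1) by simp
      then have "card S * (m / card C) = card C * (m / card C) - card (C - S) * (m / card C)"
        by (simp only: left_diff_distrib)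
      then show ?thesis
        using cardC(2) by simp
    qed
    ultimately show ?thesis
      by simp
  qed
  moreover have "p (\<Sum>C) * (\<Prod>c\<in>C. l' c) powr (m / card C) * \<theta> powr (m - ?k) \<le> p (y + w) * \<theta> powr (m - ?k)"
    unfolding yw by (rule mult_right_mono[OF IH]) simp
  ultimately show ?case
    unfolding \<theta>yw by linarith
qed

text \<open>By homogeneity both sides scale by \<theta>^m when the coefficients are divided by their
  minimum \<theta>, which reduces to coefficients at least 1.\<close>

lemma product_bound:
  fixes C :: "'a set"
  assumes C: "finite C" "C \<noteq> {}"
    and dir: "\<And>k. (\<And>c. c \<in> C \<Longrightarrow> k c > 0) \<Longrightarrow> hyp_direction (\<Sum>c\<in>C. k c *\<^sub>R c)"
    and trace: "\<And>S. S \<subseteq> C \<Longrightarrow> hyp_trace p (\<Sum>C) (\<Sum>S) = m / card C * card S"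
    and l: "\<And>c. c \<in> C \<Longrightarrow> l c > 0"
  shows "p (\<Sum>c\<in>C. l c *\<^sub>R c) \<ge> p (\<Sum>C) * (\<Prod>c\<in>C. l c) powr (m / card C)"
proof -
  define \<theta> where "\<theta> = Min (l ` C)"
  have \<theta>: "\<theta> > 0" "\<And>c. c \<in> C \<Longrightarrow> \<theta> \<le> l c"
    using C l by (auto simp: \<theta>_def)
  have "p (\<Sum>C) * (\<Prod>c\<in>C. l c / \<theta>) powr (m / card C) \<le> p (\<Sum>c\<in>C. (l c / \<theta>) *\<^sub>R c)"
    by (rule product_bound_ge_1[OF C(1) dir trace order_refl]) (use \<theta> in auto)
  moreover have "(\<Prod>c\<in>C. l c) powr (m / card C) = \<theta> ^ m * (\<Prod>c\<in>C. l c / \<theta>) powr (m / card C)"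
  proof -
    have "(\<Prod>c\<in>C. l c) = \<theta> ^ card C * (\<Prod>c\<in>C. l c / \<theta>)"
      using \<theta>(1) by (simp add: prod_dividef)
    then have "(\<Prod>c\<in>C. l c) powr (m / card C) =
        (\<theta> ^ card C) powr (m / card C) * (\<Prod>c\<in>C. l c / \<theta>) powr (m / card C)"
      using \<theta> l by (simp add: powr_mult prod_nonneg less_imp_le)
    moreover have "(\<theta> ^ card C) powr (m / card C) = \<theta> ^ m"
      using \<theta>(1) C by (simp add: powr_powr flip: powr_realpow)
    ultimately show ?thesis
      by simp
  qed
  moreover have "p (\<Sum>c\<in>C. l c *\<^sub>R c) = \<theta> ^ m * p (\<Sum>c\<in>C. (l c / \<theta>) *\<^sub>R c)"
    using \<theta>(1) by (simp flip: homogeneous add: scaleR_sum_right)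
  ultimately show ?thesis
    using \<theta>(1) by simp
qed

text \<open>A zero of \<open>F\<close> at (x, b) would make the imaginary unit a root of the line
  polynomial.\<close>

lemma hyp_direction_if_hyperbolic:
  assumes "hyperbolic m p b"
  shows "hyp_direction b"
  unfolding hyp_direction_def
proof (intro conjI allI notI)
  show "p b > 0"
    using assms by (simp add: hyperbolic_def)
  have p: "real_polynomial_function p"
    using assms by (simp add: hyperbolic_def homogeneous_polynomial_def)
  fix x assume "F (x, b) = 0"
  obtain q where q: "\<And>z. F ((x, 0) + z *\<^sub>C (b, 0)) = poly q z"
    using F_line by blast
  have "q = cpoly (line_poly p b x)"
    by (rule poly_eq_on_reals)
      (simp add: q[symmetric] cscale_pair F_real poly_cpoly_real poly_line_poly[OF p] add.commute)
  moreover have "poly q \<i> = 0"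
    using \<open>F (x, b) = 0\<close> by (simp flip: q add: cscale_pair)
  ultimately have "poly (cpoly (line_poly p b x)) \<i> = 0"
    by simp
  then have "\<i> \<in> \<real>"
    using assms unfolding hyperbolic_def by blast
  then show False
    by (simp add: complex_is_Real_iff)
qed

end

section \<open>The determinant inequality\<close>

theorem theorem1p2:
  fixes jp :: "'a::euclidean_space \<Rightarrow> 'a \<Rightarrow> 'a"
    and e b :: 'a
    and p :: "'a \<Rightarrow> real"
    and m r :: nat
  assumes "euclidean_jordan_algebra jp e"
    and "r = jordan_rank jp e"
    and "hyperbolic m p b"
    and "symmetric_cone jp e \<subseteq> garding_cone p b"
    and "central jp e m p"
  shows "\<forall>a \<in> symmetric_cone jp e.
           root m (p a) \<ge> root m (p e) * root r (jordan_det jp e a)"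
proof
  fix a assume a: "a \<in> symmetric_cone jp e"
  obtain ip where "inner_product ip" "\<forall>x y z. ip (jp x y) z = ip x (jp y z)" "jordan_algebra jp e"
    using assms(1) by (auto simp: euclidean_jordan_algebra_def)
  then interpret euclidean_jordan jp e ip
    by unfold_locales auto
  have hom: "real_polynomial_function p" "\<And>t x. p (t *\<^sub>R x) = t ^ m * p x" "m > 0"
    using assms(3) by (auto simp: hyperbolic_def homogeneous_polynomial_def)
  then obtain F where "complexification p F"
    using complexification_exists by blast
  then interpret complexified_polynomial p F m
    by unfold_locales (simp_all add: hom)
  obtain C l where C: "jordan_frame jp e C" and l: "a = (\<Sum>c\<in>C. l c *\<^sub>R c)"
    by (rule frame_decomposition_exists)
  have C': "finite C" "\<Sum>C = e" "C \<noteq> {}"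
    using C unit_nonzero by (auto simp: jordan_frame_def)
  have r: "r = card C"
    by (simp add: assms(2) jordan_rank_eq_card[OF C])
  have "r > 0"
    using C' by (simp add: r card_gt_0_iff)
  have l_pos: "l c > 0" if "c \<in> C" for c
    using a that symmetric_cone_frame[OF C l] by blast
  have dir: "hyp_direction (\<Sum>c\<in>C. k c *\<^sub>R c)" if "\<And>c. c \<in> C \<Longrightarrow> k c > 0" for k
  proof (rule hyp_direction_garding_cone[OF hyp_direction_if_hyperbolic[OF assms(3)]])
    show "(\<Sum>c\<in>C. k c *\<^sub>R c) \<in> garding_cone p b"
      using assms(4) symmetric_cone_frame[OF C refl] that by blast
  qed
  have trace: "hyp_trace p (\<Sum>C) (\<Sum>S) = m / card C * card S" if "S \<subseteq> C" for S
  proof -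
    \<comment> \<open>A partial frame sum has Jordan eigenvalues 1 on \<open>S\<close> and 0
      elsewhere, so centrality evaluates its trace at \<open>e\<close>.\<close>
    have "\<Sum>S = (\<Sum>c\<in>C. (if c \<in> S then 1 else 0) *\<^sub>R c)"
      using that C'(1) by (simp add: if_distrib[of "\<lambda>t. t *\<^sub>R _"] sum.If_cases Int_absorb1 cong: if_cong)
    from jordan_trace_frame[OF C this] have "jordan_trace jp e (\<Sum>S) = card S"
      using that C'(1) by (simp add: sum.If_cases Int_absorb1)
    then show ?thesis
      using assms(5) by (simp add: central_def C'(2) jordan_rank_eq_card[OF C])
  qed
  define D where "D = jordan_det jp e a"
  have D: "D = (\<Prod>c\<in>C. l c)" "D > 0"
    using l_pos by (auto simp: D_def jordan_det_frame[OF C l] intro: prod_pos)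
  have "p e > 0"
    using dir[of "\<lambda>_. 1"] C'(2) by (simp add: hyp_direction_def)
  have "root m (D powr (m / r)) = root r D"
    using hom(3) \<open>r > 0\<close> D(2) by (simp add: root_powr_inverse powr_powr)
  then have "root m (p e) * root r D = root m (p e * D powr (m / r))"
    by (simp add: real_root_mult)
  also have "\<dots> \<le> root m (p a)"
    using product_bound[OF C'(1,3) dir trace l_pos] hom(3) by (simp add: C'(2) D(1) l r)
  finally show "root m (p a) \<ge> root m (p e) * root r (jordan_det jp e a)"
    by (simp add: D_def)
qed

end
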